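(* Let $d\ge1$ be an integer, $\beta\in(0,d]$, and let $Q_0\subset\mathbb{R}^d$ be a fixed cube. Suppose $\mu$ is a locally finite (signed) Radon measure in $\mathbb{R}^d$ such that $$\int_Q \mathcal{M}^{Q_0}_{d-\beta}(\mu) \;d\mathcal{H}_\infty^\beta <+\infty$$ for any cube $Q\subset \mathbb{R}^d$. Then $\dim_{\mathcal{H}} \mu \geq \beta$.
   Context: Cubes are bounded with sides parallel to the axes; $l(Q)$ is the side length of $Q$. Dyadic cubes generated by $Q_0=c+[0,\ell)^d$: $\mathcal{D}(Q_0)$ is the set of all cubes $c+2^{-k}\ell(\mathbf{n}+[0,1)^d)$, $k\in\mathbb{Z}$, $\mathbf{n}\in\mathbb{Z}^d$ (the whole dyadic lattice generated by $Q_0$, not only subcubes of $Q_0$). Dyadic fractional maximal function, for $\gamma\in[0,d]$: $\mathcal{M}^{Q_0}_{\gamma}(\mu)(x):=\sup_{Q \in \mathcal{D}(Q_0)} \chi_Q(x) \frac{|\mu(Q)|}{l(Q)^{d-\gamma}}$ (so for $\gamma=d-\beta$ the denominator is $l(Q)^\beta$). Spherical Hausdorff content: $\mathcal{H}_\infty^\beta(E):= \inf \left\{ \sum_{i=1}^\infty \omega_\beta r_i^\beta : E \subset \bigcup_{i=1}^\infty B(x_i,r_i)\right\}$, $\omega_\beta= \pi^{\beta/2}/\Gamma(\beta/2+1)$. Choquet integral: for an everywhere defined $f:\mathbb{R}^d\to[0,\infty]$, $\int_Q f \,d\mathcal{H}_\infty^\beta := \int_0^\infty \mathcal{H}_\infty^\beta(\{x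 \in Q : f(x)>t\})\,dt$. Lower Hausdorff dimension of a measure: $\dim_{\mathcal{H}}\mu=\sup\{\beta\in(0,d]: \mathcal{H}^\beta(E)=0 \implies |\mu|(E)=0\}$ (the implication being required for all Borel sets $E$), where $|\mu|$ is the total variation measure and $\mathcal{H}^\beta$ is Hausdorff measure. *)

theory Defs
  imports "HOL-Analysis.Analysis"
begin

section \<open>Cubes and dyadic lattices\<close>

text \<open>The ambient space is a Euclidean space \<open>'a\<close> of dimension \<open>d = DIM('a) \<ge> 1\<close>;
  coordinates are taken with respect to the orthonormal basis \<open>Basis\<close>.
  Throughout, a cube is half-open, \<open>c + [0,l)\<^sup>d\<close> with \<open>l > 0\<close>.\<close>

definition cube :: "'a::euclidean_space \<Rightarrow> real \<Rightarrow> 'a set" where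
  "cube c l = {x. \<forall>b\<in>Basis. c \<bullet> b \<le> x \<bullet> b \<and> x \<bullet> b < c \<bullet> b + l}"

definition is_cube :: "'a::euclidean_space set \<Rightarrow> bool" where
  "is_cube Q \<longleftrightarrow> (\<exists>c l. 0 < l \<and> Q = cube c l)"

definition side_length :: "'a::euclidean_space set \<Rightarrow> real" where
  "side_length Q = (THE l. 0 < l \<and> (\<exists>c. Q = cube c l))"

lemma cube_eq_imp_side_le:
  fixes c c' :: "'a::euclidean_space"
  assumes "0 < l'" "cube c l = cube c' l'"
  shows "l' \<le> l"
proof (rule ccontr)
  assume "\<not> l' \<le> l"
  hence less: "l < l'" by simp
  have "c' \<in> cube c l" using assms by (simp add: assms(2) cube_def)
  moreover obtain b :: 'a where b: "b \<in> Basis" using nonempty_Basis by blast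
  ultimately have c': "c \<bullet> b \<le> c' \<bullet> b" "c' \<bullet> b < c \<bullet> b + l"
    by (auto simp: cube_def)
  hence "0 \<le> l" by linarith
  hence "c' + l *\<^sub>R b \<in> cube c' l'"
    using less b assms(1) by (auto simp: cube_def inner_add_left inner_Basis)
  hence "c' + l *\<^sub>R b \<in> cube c l" by (simp add: assms(2))
  hence "c' \<bullet> b + l < c \<bullet> b + l" using b by (auto simp: cube_def inner_add_left)
  with c' show False by simp
qed

lemma side_length_cube:
  assumes "0 < l"
  shows "side_length (cube (c::'a::euclidean_space) l) = l"
  unfolding side_length_def
proof (rule the_equality)
  show "0 < l \<and> (\<exists>c'. cube c l = cube c' l)" using assms by blast
  show "l' = l" if "0 < l' \<and> (\<exists>c'. cube c l = cube c' l')" for l'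
    using that assms cube_eq_imp_side_le by (metis order_antisym)
qed

text \<open>The family of all cubes \<open>c + 2\<^sup>-\<^sup>k l (n + [0,1)\<^sup>d)\<close> with \<open>k \<in> \<int>\<close> and
  \<open>n \<in> \<int>\<^sup>d\<close>, where \<open>Q0 = c + [0,l)\<^sup>d\<close>.  All scales occur, not only subcubes of \<open>Q0\<close>.\<close>

definition dyadic_cubes :: "'a::euclidean_space set \<Rightarrow> 'a set set" where
  "dyadic_cubes Q0 =
    {cube (c + (2 powi (-k) * l) *\<^sub>R (\<Sum>b\<in>Basis. of_int (n b) *\<^sub>R b)) (2 powi (-k) * l)
      | c l (k::int) (n::'a \<Rightarrow> int). 0 < l \<and> Q0 = cube c l}"


section \<open>Locally finite signed measures\<close>

text \<open>A locally finite signed measure may have infinite positive and negative parts, so that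
  its value is meaningful only on bounded Borel sets.  It is represented by a real-valued set
  function that is countably additive on bounded Borel sets; its values on all other sets are
  irrelevant.  The total variation is nevertheless defined on every Borel set, as the supremum of
  \<open>\<Sum>\<^sub>i \<bar>\<mu>(A\<^sub>i)\<bar>\<close> over finite disjoint families of bounded Borel subsets.
  On a Euclidean space every locally finite Borel measure is regular, i.e. Radon.\<close>

definition total_variation :: "('a::euclidean_space set \<Rightarrow> real) \<Rightarrow> 'a set \<Rightarrow> ennreal" where
  "total_variation \<mu> E =
    (SUP \<A>\<in>{\<A>. finite \<A> \<and> disjoint \<A> \<and> (\<forall>A\<in>\<A>. A \<in> sets borel \<and> bounded A \<and> A \<subseteq> E)}.
       \<Sum>A\<in>\<A>. ennreal \<bar>\<mu> A\<bar>)"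

definition signed_radon_measure :: "('a::euclidean_space set \<Rightarrow> real) \<Rightarrow> bool" where
  "signed_radon_measure \<mu> \<longleftrightarrow>
    (\<forall>A :: nat \<Rightarrow> 'a set.
       range A \<subseteq> sets borel \<and> disjoint_family A \<and> bounded (\<Union>i. A i) \<longrightarrow>
       (\<lambda>i. \<mu> (A i)) sums \<mu> (\<Union>i. A i)) \<and>
    (\<forall>K. compact K \<longrightarrow> total_variation \<mu> K < \<infinity>)"


section \<open>The dyadic fractional maximal function\<close>

definition dyadic_frac_maximal ::
  "real \<Rightarrow> 'a::euclidean_space set \<Rightarrow> ('a set \<Rightarrow> real) \<Rightarrow> 'a \<Rightarrow> ennreal" where
  "dyadic_frac_maximal \<gamma> Q0 \<mu> x =
    (SUP Q\<in>dyadic_cubes Q0.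
       indicator Q x * ennreal (\<bar>\<mu> Q\<bar> / side_length Q powr (real DIM('a) - \<gamma>)))"


section \<open>Hausdorff content, Choquet integral, Hausdorff measure and dimension\<close>

text \<open>The constant \<^const>\<open>unit_ball_vol\<close> \<open>\<beta>\<close> is \<open>\<pi>\<^sup>\<beta>\<^sup>/\<^sup>2 / \<Gamma>(\<beta>/2 + 1)\<close> for every real
  \<open>\<beta> \<ge> 0\<close>.  Radius 0 (an empty open ball, contributing 0 since \<open>\<beta> > 0\<close>) is allowed, so that
  finite covers are included.\<close>

definition hausdorff_content :: "real \<Rightarrow> 'a::euclidean_space set \<Rightarrow> ennreal" where
  "hausdorff_content \<beta> E =
    Inf {\<Sum>i. ennreal (unit_ball_vol \<beta> * r i powr \<beta>)
      | (x :: nat \<Rightarrow> 'a) (r :: nat \<Rightarrow> real). (\<forall>i. 0 \<le> r i) \<and> E \<subseteq> (\<Union>i. ball (x i) (r i))}"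

definition choquet_integral ::
  "('a set \<Rightarrow> ennreal) \<Rightarrow> 'a set \<Rightarrow> ('a \<Rightarrow> ennreal) \<Rightarrow> ennreal" where
  "choquet_integral H Q f = (\<integral>\<^sup>+ t\<in>{0..}. H {x \<in> Q. ennreal t < f x} \<partial>lborel)"

text \<open>The covering sets are required to be bounded because \<^const>\<open>diameter\<close> is unspecified on
  unbounded sets.\<close>

definition hausdorff_premeasure :: "real \<Rightarrow> real \<Rightarrow> 'a::euclidean_space set \<Rightarrow> ennreal" where
  "hausdorff_premeasure \<beta> \<delta> E =
    Inf {\<Sum>i. ennreal (unit_ball_vol \<beta> * (diameter (A i) / 2) powr \<beta>)
      | A :: nat \<Rightarrow> 'a set. (\<forall>i. bounded (A i) \<and> diameter (A i) \<le> \<delta>) \<and> E \<subseteq> (\<Union>i. A i)}"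

definition hausdorff_measure :: "real \<Rightarrow> 'a::euclidean_space set \<Rightarrow> ennreal" where
  "hausdorff_measure \<beta> E = (SUP \<delta>\<in>{0<..}. hausdorff_premeasure \<beta> \<delta> E)"

text \<open>Extended-real valued so that the supremum of the empty set is 0
  (as for a Dirac measure).\<close>

definition lower_hausdorff_dim :: "('a::euclidean_space set \<Rightarrow> real) \<Rightarrow> ennreal" where
  "lower_hausdorff_dim \<mu> =
    (SUP \<beta>\<in>{\<beta>. 0 < \<beta> \<and> \<beta> \<le> real DIM('a) \<and>
              (\<forall>E\<in>sets borel. hausdorff_measure \<beta> E = 0 \<longrightarrow> total_variation \<mu> E = 0)}.
       ennreal \<beta>)"

end

theory Submission
  imports Defs
begin

text \<open>
The assertion is reduced to absolute continuity: a Borel set of vanishing \<open>\<beta>\<close>-dimensional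
Hausdorff measure has vanishing total variation, so that \<open>\<beta>\<close> itself competes in the supremum that
defines the dimension. By countable additivity it suffices to show \<open>\<mu> A = 0\<close> for every Hausdorff
null Borel set \<open>A\<close> inside one cube \<open>Q\<close> of the lattice.

Finiteness of the Choquet integral makes \<open>t * H {x \<in> Q. M x > t}\<close> small for arbitrarily large \<open>t\<close>,
where \<open>M\<close> is the maximal function and \<open>H\<close> the content (\<open>choquet_integral_finite_imp_small\<close>). Hence
\<open>A \<union> {x \<in> Q. M x > t}\<close> is covered by lattice cubes \<open>R\<close> with
\<open>\<Sum> side(R)\<^sup>\<beta> \<le> \<epsilon> / t\<close>. These cubes cannot be used directly, because \<open>\<mu>\<close> may be large on
them. A stopping-time argument (\<open>stopping_cube_exists\<close>) therefore replaces those contained in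
some cube \<open>S\<close> with \<open>\<bar>\<mu>(S)\<bar> > t side(S)\<^sup>\<beta>\<close> by the parent of a maximal such \<open>S\<close>. The cube \<open>S\<close>
lies in \<open>{M > t}\<close>, so it is itself covered by the \<open>R\<close>; when none of them is larger than \<open>S\<close>, the
side of \<open>S\<close> is controlled by theirs because \<open>\<beta> \<le> d\<close>. The coarsest of the cubes obtained form a disjoint
family of cubes \<open>S'\<close> with \<open>\<bar>\<mu>(S')\<bar> \<le> t side(S')\<^sup>\<beta>\<close> and
\<open>\<Sum> side(S')\<^sup>\<beta> \<le> 2\<^sup>\<beta> \<epsilon> / t\<close>, whose union \<open>U\<close> satisfies \<open>\<bar>\<mu>(U)\<bar> \<le> 2\<^sup>\<beta> \<epsilon>\<close>
(\<open>stopping_cubes_union_bound\<close>).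

It remains to compare \<open>\<mu>(U)\<close> with \<open>\<mu>(A)\<close>. Regularity of the total variation provides a compact
\<open>E \<subseteq> A\<close> and an open \<open>V \<supseteq> E\<close> such that \<open>A - E\<close> and \<open>V - E\<close> have small variation. Performing
the construction for the points of \<open>E\<close> with \<open>t\<close> large makes all cubes so small that
\<open>E \<subseteq> U \<subseteq> V\<close>; then \<open>\<mu>(A)\<close>, \<open>\<mu>(E)\<close> and \<open>\<mu>(U)\<close> are close to each other
(\<open>hausdorff_null_imp_null_in_cube\<close>).
\<close>

section \<open>Dyadic grids\<close>

definition mesh :: "real \<Rightarrow> nat \<Rightarrow> real" where
  "mesh l k = l / 2 ^ k"

text \<open>A cube of generation \<open>k\<close> is named by any of its points. The floor condition makes ``lying in
the same cube'' an equivalence relation, so that equality, disjointness and nestedness of cubes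
reduce to arithmetic of floors. Only \<open>k \<ge> 0\<close> occurs: the large cubes of the lattice only increase
the maximal function.\<close>

definition grid_cube :: "'a::euclidean_space \<Rightarrow> real \<Rightarrow> nat \<Rightarrow> 'a \<Rightarrow> 'a set" where
  "grid_cube c l k x =
    {y. \<forall>b\<in>Basis. \<lfloor>(y - c) \<bullet> b / mesh l k\<rfloor> = \<lfloor>(x - c) \<bullet> b / mesh l k\<rfloor>}"

lemma mesh_pos: "0 < l \<Longrightarrow> 0 < mesh l k"
  by (simp add: mesh_def)

lemma mesh_0 [simp]: "mesh l 0 = l"
  by (simp add: mesh_def)

lemma mesh_Suc: "mesh l k = 2 * mesh l (Suc k)"
  by (simp add: mesh_def)

lemma mem_grid_cube_self [simp]: "x \<in> grid_cube c l k x"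
  by (simp add: grid_cube_def)

lemma grid_cube_eq: "y \<in> grid_cube c l k x \<Longrightarrow> grid_cube c l k y = grid_cube c l k x"
  by (auto simp: grid_cube_def)

lemma grid_cube_sym: "y \<in> grid_cube c l k x \<longleftrightarrow> x \<in> grid_cube c l k y"
  by (auto simp: grid_cube_def)

lemma grid_cube_antimono:
  assumes "i \<le> k"
  shows "grid_cube c l k x \<subseteq> grid_cube c l i x"
  using assms
proof (induction k rule: dec_induct)
  case (step k)
  have "grid_cube c l (Suc k) x \<subseteq> grid_cube c l k x"
  proof
    fix y assume y: "y \<in> grid_cube c l (Suc k) x"
    have half: "\<lfloor>u / mesh l k\<rfloor> = \<lfloor>u / mesh l (Suc k)\<rfloor> div 2" for u
    proof -
      have "u / mesh l k = u / mesh l (Suc k) / 2"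
        by (simp add: mesh_def)
      also have "\<lfloor>\<dots>\<rfloor> = \<lfloor>u / mesh l (Suc k)\<rfloor> div 2"
        using floor_divide_real_eq_div[of 2 "u / mesh l (Suc k)"] by simp
      finally show ?thesis .
    qed
    show "y \<in> grid_cube c l k x"
      using y by (simp add: grid_cube_def half)
  qed
  with step.IH show ?case by blast
qed simp

lemma grid_cube_eq_cube:
  fixes c x :: "'a::euclidean_space"
  assumes "0 < l"
  shows "grid_cube c l k x =
    cube (c + mesh l k *\<^sub>R (\<Sum>b\<in>Basis. of_int \<lfloor>(x - c) \<bullet> b / mesh l k\<rfloor> *\<^sub>R b)) (mesh l k)"
proof -
  let ?s = "mesh l k"
  have s: "0 < ?s" using mesh_pos[OF assms] .
  have fl: "\<lfloor>u / ?s\<rfloor> = n \<longleftrightarrow> of_int n * ?s \<le> u \<and> u < of_int n * ?s + ?s" for u n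
    using s by (simp add: floor_eq_iff pos_le_divide_eq pos_divide_less_eq algebra_simps)
  show ?thesis
    by (auto simp: grid_cube_def cube_def fl inner_add_left inner_diff_left inner_sum_left_Basis
        algebra_simps)
qed

lemma grid_cube_in_dyadic_cubes:
  assumes "0 < l"
  shows "grid_cube c l k x \<in> dyadic_cubes (cube c l)"
proof -
  have "mesh l k = 2 powi (- int k) * l"
    by (simp add: mesh_def power_int_minus divide_inverse)
  then show ?thesis
    unfolding dyadic_cubes_def grid_cube_eq_cube[OF assms] mem_Collect_eq
    using assms
    by (intro exI[of _ c] exI[of _ l] exI[of _ "int k"]
        exI[of _ "\<lambda>b. \<lfloor>(x - c) \<bullet> b / mesh l k\<rfloor>"]) simp
qed

lemma side_length_grid_cube: "0 < l \<Longrightarrow> side_length (grid_cube c l k x) = mesh l k"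
  by (simp add: grid_cube_eq_cube side_length_cube mesh_pos)

lemma is_cube_grid_cube: "0 < l \<Longrightarrow> is_cube (grid_cube c l k x)"
  unfolding is_cube_def grid_cube_eq_cube using mesh_pos by blast

lemma cube_borel [measurable]: "cube c s \<in> sets borel"
proof -
  have "cube c s = {x \<in> space borel. \<forall>b\<in>Basis. c \<bullet> b \<le> x \<bullet> b \<and> x \<bullet> b < c \<bullet> b + s}"
    by (simp add: cube_def)
  also have "\<dots> \<in> sets borel" by measurable
  finally show ?thesis .
qed

lemma cube_subset_cbox: "cube c s \<subseteq> cbox c (c + s *\<^sub>R One)"
  by (fastforce simp: cube_def mem_box inner_add_left inner_sum_left_Basis)

lemma box_subset_cube: "box c (c + s *\<^sub>R One) \<subseteq> cube c s"
  by (auto simp: cube_def mem_box inner_add_left inner_sum_left_Basis intro: less_imp_le)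

lemma emeasure_lborel_cube:
  fixes c :: "'a::euclidean_space"
  assumes "0 \<le> s"
  shows "emeasure lborel (cube c s) = ennreal (s ^ DIM('a))"
proof (rule antisym)
  have "emeasure lborel (cube c s) \<le> emeasure lborel (cbox c (c + s *\<^sub>R One))"
    by (intro emeasure_mono cube_subset_cbox) auto
  also have "\<dots> = ennreal (s ^ DIM('a))"
    using assms by (subst emeasure_lborel_cbox) (auto simp: inner_add_left inner_sum_left_Basis)
  finally show "emeasure lborel (cube c s) \<le> ennreal (s ^ DIM('a))" .
  have "ennreal (s ^ DIM('a)) = emeasure lborel (box c (c + s *\<^sub>R One))"
    using assms by (subst emeasure_lborel_box) (auto simp: inner_add_left inner_sum_left_Basis)
  also have "\<dots> \<le> emeasure lborel (cube c s)"
    by (intro emeasure_mono box_subset_cube) auto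
  finally show "ennreal (s ^ DIM('a)) \<le> emeasure lborel (cube c s)" .
qed

lemma grid_cube_borel [measurable]: "0 < l \<Longrightarrow> grid_cube c l k x \<in> sets borel"
  by (simp add: grid_cube_eq_cube cube_borel)

lemma bounded_grid_cube: "0 < l \<Longrightarrow> bounded (grid_cube c l k x)"
  unfolding grid_cube_eq_cube by (rule bounded_subset[OF bounded_cbox cube_subset_cbox])

lemma dist_grid_cube_less:
  fixes x y :: "'a::euclidean_space"
  assumes "0 < l" "y \<in> grid_cube c l k x"
  shows "dist x y < real DIM('a) * mesh l k"
proof -
  have "\<bar>(x - y) \<bullet> b\<bar> < mesh l k" if "b \<in> Basis" for b
    using assms(2) that mem_grid_cube_self[of x c l k]
    unfolding grid_cube_eq_cube[OF assms(1)] cube_def by (fastforce simp: inner_diff_left)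
  then have "(\<Sum>b\<in>Basis. \<bar>(x - y) \<bullet> b\<bar>) < (\<Sum>b\<in>(Basis::'a set). mesh l k)"
    by (intro sum_strict_mono) auto
  then show ?thesis
    using norm_le_l1[of "x - y"] by (simp add: dist_norm)
qed

section \<open>The cost of a family of grid cubes\<close>

text \<open>A family of cubes is a set of pairs (generation, point), and its cost \<open>\<Sum> side\<^sup>\<beta>\<close> is read off
a measure on all such pairs. The cost of the members whose named points lie in a set \<open>S\<close>
is then countably additive in \<open>S\<close>, and this is what sums over disjoint cubes need below.\<close>

definition cost :: "real \<Rightarrow> real \<Rightarrow> (nat \<times> 'a) measure" where
  "cost l \<beta> = density (count_space UNIV) (\<lambda>(k, y). ennreal (mesh l k powr \<beta>))"

lemma sets_cost [simp, measurable_cong]: "sets (cost l \<beta>) = UNIV"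
  by (simp add: cost_def)

lemma emeasure_cost:
  "emeasure (cost l \<beta>) P = (\<integral>\<^sup>+p. ennreal (mesh l (fst p) powr \<beta>) \<partial>count_space P)"
  unfolding cost_def
  by (subst emeasure_density)
    (auto simp: nn_integral_count_space_indicator split_beta intro!: nn_integral_cong)

lemma emeasure_cost_single: "emeasure (cost l \<beta>) {p} = ennreal (mesh l (fst p) powr \<beta>)"
  by (simp add: emeasure_cost nn_integral_count_space_finite)

lemma emeasure_cost_mono: "P \<subseteq> P' \<Longrightarrow> emeasure (cost l \<beta>) P \<le> emeasure (cost l \<beta>) P'"
  by (rule emeasure_mono) auto

text \<open>Covering a cube by smaller ones cannot reduce the cost: for the exponent \<open>d\<close> this is
subadditivity of volume, and for \<open>\<beta> \<le> d\<close> passing from \<open>d\<close> to \<open>\<beta>\<close> multiplies the contribution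
of a cube of side \<open>s\<close> by \<open>s\<^sup>\<beta>\<^sup>-\<^sup>d\<close>, a factor that is largest for the small cubes.\<close>

lemma mesh_powr_le_cost_of_cover:
  fixes x :: "'a::euclidean_space"
  assumes l: "0 < l" and b: "\<beta> \<le> real DIM('a)"
    and P: "countable P" "\<And>p. p \<in> P \<Longrightarrow> j \<le> fst p"
    and cov: "grid_cube c l j x \<subseteq> (\<Union>(k, y)\<in>P. grid_cube c l k y)"
  shows "ennreal (mesh l j powr \<beta>) \<le> emeasure (cost l \<beta>) P"
proof -
  let ?d = "DIM('a)" and ?s = "mesh l j"
  let ?C = "\<lambda>p. grid_cube c l (fst p) (snd p)"
  have s: "0 < ?s" using mesh_pos[OF l] .
  have vol: "emeasure lborel (grid_cube c l k y) = ennreal (mesh l k ^ ?d)" for k and y :: 'a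
    using mesh_pos[OF l, of k] by (simp add: grid_cube_eq_cube[OF l] emeasure_lborel_cube)
  have "ennreal (?s ^ ?d) = (\<integral>\<^sup>+z. indicator (grid_cube c l j x) z \<partial>lborel)"
    using l by (simp add: vol)
  also have "\<dots> \<le> (\<integral>\<^sup>+z. \<integral>\<^sup>+p. indicator (?C p) z \<partial>count_space P \<partial>lborel)"
  proof (rule nn_integral_mono)
    fix z :: 'a
    show "indicator (grid_cube c l j x) z \<le> (\<integral>\<^sup>+p. indicator (?C p) z \<partial>count_space P)"
    proof (cases "z \<in> grid_cube c l j x")
      case True
      with cov obtain p where "p \<in> P" "z \<in> ?C p" by fastforce
      then show ?thesis
        using nn_integral_ge_point[of p P "\<lambda>p. indicator (?C p) z"] True by simp
    qed simp
  qed
  also have "\<dots> = (\<integral>\<^sup>+p. \<integral>\<^sup>+z. indicator (?C p) z \<partial>lborel \<partial>count_space P)"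
    using l P(1) by (intro nn_integral_count_space_nn_integral) auto
  also have "\<dots> = (\<integral>\<^sup>+p. ennreal (mesh l (fst p) ^ ?d) \<partial>count_space P)"
    using l by (simp add: vol)
  also have "\<dots> \<le> (\<integral>\<^sup>+p. ennreal (?s powr (?d - \<beta>)) * ennreal (mesh l (fst p) powr \<beta>) \<partial>count_space P)"
  proof (rule nn_integral_mono)
    fix p assume "p \<in> space (count_space P)"
    then have le: "mesh l (fst p) \<le> ?s"
      using P(2)[of p] l by (simp add: mesh_def frac_le)
    have m: "0 < mesh l (fst p)" using mesh_pos[OF l] .
    have "mesh l (fst p) ^ ?d = mesh l (fst p) powr (?d - \<beta>) * mesh l (fst p) powr \<beta>"
      using m by (simp add: powr_realpow flip: powr_add)
    also have "\<dots> \<le> ?s powr (?d - \<beta>) * mesh l (fst p) powr \<beta>"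
      using le m b by (intro mult_right_mono powr_mono2) auto
    finally show "ennreal (mesh l (fst p) ^ ?d)
        \<le> ennreal (?s powr (?d - \<beta>)) * ennreal (mesh l (fst p) powr \<beta>)"
      by (simp add: ennreal_leI flip: ennreal_mult)
  qed
  also have "\<dots> = ennreal (?s powr (?d - \<beta>)) * emeasure (cost l \<beta>) P"
    by (simp add: nn_integral_cmult emeasure_cost)
  finally have main: "ennreal (?s ^ ?d) \<le> ennreal (?s powr (?d - \<beta>)) * emeasure (cost l \<beta>) P" .
  have "?s powr (?d - \<beta>) * ?s powr \<beta> = ?s ^ ?d"
    using s by (simp add: powr_realpow flip: powr_add)
  then have "ennreal (?s powr (?d - \<beta>)) * ennreal (?s powr \<beta>)
      \<le> ennreal (?s powr (?d - \<beta>)) * emeasure (cost l \<beta>) P"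
    using main by (simp flip: ennreal_mult)
  moreover have "0 < ennreal (?s powr (?d - \<beta>))" "ennreal (?s powr (?d - \<beta>)) < top"
    using s by auto
  ultimately show ?thesis by (simp add: ennreal_mult_le_mult_iff)
qed

section \<open>Signed measures and their total variation\<close>

lemma signed_measure_sums:
  assumes "signed_radon_measure \<mu>" "range A \<subseteq> sets borel" "disjoint_family A" "bounded (\<Union>i. A i)"
  shows "(\<lambda>i. \<mu> (A i)) sums \<mu> (\<Union>i::nat. A i)"
  using assms unfolding signed_radon_measure_def by blast

lemma signed_measure_empty:
  assumes "signed_radon_measure \<mu>"
  shows "\<mu> {} = 0"
proof -
  have "(\<lambda>i::nat. \<mu> {}) sums \<mu> (\<Union>i::nat. {})"
    by (rule signed_measure_sums[OF assms]) (auto simp: disjoint_family_on_def)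
  then have "(\<lambda>i::nat. \<mu> {}) \<longlonglongrightarrow> 0"
    using sums_summable summable_LIMSEQ_zero by blast
  then show ?thesis by (simp add: LIMSEQ_const_iff)
qed

lemma signed_measure_Un:
  assumes \<mu>: "signed_radon_measure \<mu>"
    and "A \<in> sets borel" "B \<in> sets borel" "bounded A" "bounded B" "A \<inter> B = {}"
  shows "\<mu> (A \<union> B) = \<mu> A + \<mu> B"
proof -
  let ?X = "\<lambda>i::nat. if i = 0 then A else if i = 1 then B else {}"
  have U: "(\<Union>i. ?X i) = A \<union> B"
    by (auto split: if_splits)
  have "(\<lambda>i. \<mu> (?X i)) sums \<mu> (\<Union>i. ?X i)"
    using assms by (intro signed_measure_sums[OF \<mu>]) (auto simp: disjoint_family_on_def U)
  moreover have "(\<lambda>i. \<mu> (?X i)) sums (\<Sum>i\<in>{0,1}. \<mu> (?X i))"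
    by (rule sums_finite) (auto simp: signed_measure_empty[OF \<mu>])
  ultimately show ?thesis
    unfolding U using sums_unique2 by fastforce
qed

lemma abs_signed_measure_le_suminf:
  assumes "signed_radon_measure \<mu>" "range A \<subseteq> sets borel" "disjoint_family A" "bounded (\<Union>i. A i)"
  shows "ennreal \<bar>\<mu> (\<Union>i::nat. A i)\<bar> \<le> (\<Sum>i. ennreal \<bar>\<mu> (A i)\<bar>)"
proof (cases "(\<Sum>i. ennreal \<bar>\<mu> (A i)\<bar>) = top")
  case False
  then have summ: "summable (\<lambda>i. \<bar>\<mu> (A i)\<bar>)"
    by (intro summable_suminf_not_top) auto
  have "\<bar>\<mu> (\<Union>i. A i)\<bar> \<le> (\<Sum>i. \<bar>\<mu> (A i)\<bar>)"
    using summable_rabs[OF summ] signed_measure_sums[OF assms] by (simp add: sums_iff)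
  then show ?thesis
    using summ by (subst suminf_ennreal2) (auto intro: ennreal_leI)
qed simp

text \<open>The countable pieces have no natural enumeration, so the sum is an integral over \<open>\<D>\<close> itself.\<close>

lemma abs_signed_measure_le_partition:
  assumes \<mu>: "signed_radon_measure \<mu>"
    and D: "countable \<D>" "disjoint \<D>" "\<D> \<subseteq> sets borel"
    and A: "A \<in> sets borel" "bounded A" "A \<subseteq> \<Union>\<D>"
  shows "ennreal \<bar>\<mu> A\<bar> \<le> (\<integral>\<^sup>+S. ennreal \<bar>\<mu> (A \<inter> S)\<bar> \<partial>count_space \<D>)"
proof -
  let ?f = "to_nat_on \<D>"
  define T where "T n = (if n \<in> ?f ` \<D> then A \<inter> from_nat_into \<D> n else {})" for n
  have T_f: "T (?f S) = A \<inter> S" if "S \<in> \<D>" for S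
    using that D(1) by (simp add: T_def)
  have T_empty: "T n = {}" if "n \<notin> ?f ` \<D>" for n
    using that by (simp add: T_def)
  have T_cases: "T n = {} \<or> (\<exists>S\<in>\<D>. n = ?f S \<and> T n = A \<inter> S)" for n
    using T_f T_empty by (metis imageE)
  have U: "(\<Union>n. T n) = A"
  proof
    show "(\<Union>n. T n) \<subseteq> A" using T_cases by blast
    show "A \<subseteq> (\<Union>n. T n)" using A(3) T_f by blast
  qed
  have "disjoint_family T"
    unfolding disjoint_family_on_def
  proof (intro ballI impI)
    fix m n :: nat assume "m \<noteq> n"
    then show "T m \<inter> T n = {}"
      using T_cases[of m] T_cases[of n] D(2) unfolding disjoint_def by fastforce
  qed
  moreover have "range T \<subseteq> sets borel"
  proof safe
    fix n
    show "T n \<in> sets borel" using T_cases[of n] A(1) D(3) by auto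
  qed
  ultimately have "ennreal \<bar>\<mu> A\<bar> \<le> (\<Sum>n. ennreal \<bar>\<mu> (T n)\<bar>)"
    using abs_signed_measure_le_suminf[OF \<mu>, of T] A(2) unfolding U by blast
  also have "\<dots> = (\<integral>\<^sup>+n. ennreal \<bar>\<mu> (T n)\<bar> \<partial>count_space UNIV)"
    by (rule nn_integral_count_space_nat[symmetric])
  also have "\<dots> = (\<integral>\<^sup>+n. ennreal \<bar>\<mu> (T n)\<bar> \<partial>count_space (?f ` \<D>))"
    using signed_measure_empty[OF \<mu>] T_empty
    by (intro nn_integral_count_space_eq) auto
  also have "\<dots> = (\<integral>\<^sup>+S. ennreal \<bar>\<mu> (T (?f S))\<bar> \<partial>count_space \<D>)"
    by (intro nn_integral_bij_count_space[symmetric] inj_on_imp_bij_betw inj_on_to_nat_on D)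
  also have "\<dots> = (\<integral>\<^sup>+S. ennreal \<bar>\<mu> (A \<inter> S)\<bar> \<partial>count_space \<D>)"
    by (rule nn_integral_cong) (simp add: T_f)
  finally show ?thesis .
qed

lemma total_variation_upper:
  assumes "finite \<A>" "disjoint \<A>" "\<And>A. A \<in> \<A> \<Longrightarrow> A \<in> sets borel \<and> bounded A \<and> A \<subseteq> E"
  shows "(\<Sum>A\<in>\<A>. ennreal \<bar>\<mu> A\<bar>) \<le> total_variation \<mu> E"
  unfolding total_variation_def using assms by (intro SUP_upper) auto

lemma total_variation_mono: "E \<subseteq> F \<Longrightarrow> total_variation \<mu> E \<le> total_variation \<mu> F"
  unfolding total_variation_def by (intro SUP_subset_mono) auto

lemma abs_le_total_variation:
  assumes "A \<in> sets borel" "bounded A"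
  shows "ennreal \<bar>\<mu> A\<bar> \<le> total_variation \<mu> A"
  using total_variation_upper[of "{A}" A \<mu>] assms by simp

text \<open>Admissible families for \<open>A\<close> and for \<open>B\<close> can share only the empty set, which has measure zero, so
their union is admissible for \<open>A \<union> B\<close> with the sum of the two values.\<close>

lemma total_variation_superadditive:
  assumes \<mu>: "signed_radon_measure \<mu>" and "A \<inter> B = {}"
  shows "total_variation \<mu> A + total_variation \<mu> B \<le> total_variation \<mu> (A \<union> B)"
proof -
  let ?F = "\<lambda>E. {\<A>. finite \<A> \<and> disjoint \<A> \<and> (\<forall>A\<in>\<A>. A \<in> sets borel \<and> bounded A \<and> A \<subseteq> E)}"
  let ?S = "\<lambda>\<A>. \<Sum>A\<in>\<A>. ennreal \<bar>\<mu> A\<bar>"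
  have le: "?S \<A> + ?S \<B> \<le> total_variation \<mu> (A \<union> B)" if "\<A> \<in> ?F A" "\<B> \<in> ?F B" for \<A> \<B>
  proof -
    have cap: "\<A> \<inter> \<B> \<subseteq> {{}}" using that assms(2) by fastforce
    have "?S \<A> + ?S \<B> = ?S (\<A> \<union> \<B>) + ?S (\<A> \<inter> \<B>)"
      using that by (intro sum.union_inter[symmetric]) auto
    also have "?S (\<A> \<inter> \<B>) = 0"
      using cap signed_measure_empty[OF \<mu>] by (intro sum.neutral) auto
    also have "?S (\<A> \<union> \<B>) + 0 \<le> total_variation \<mu> (A \<union> B)"
    proof -
      have "disjoint (\<A> \<union> \<B>)"
      proof (rule disjoint_union)
        have "\<Union>\<A> \<subseteq> A" "\<Union>\<B> \<subseteq> B" using that by blast+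
        then show "\<Union>\<A> \<inter> \<Union>\<B> = {}" using assms(2) by blast
      qed (use that in auto)
      then show ?thesis
        using that total_variation_upper[of "\<A> \<union> \<B>" "A \<union> B" \<mu>] by auto
    qed
    finally show ?thesis .
  qed
  have nonempty: "?F E \<noteq> {}" for E :: "'a set"
    by (auto intro!: exI[of _ "{}"])
  have "total_variation \<mu> A + total_variation \<mu> B = (SUP \<A>\<in>?F A. ?S \<A> + total_variation \<mu> B)"
    unfolding total_variation_def[of \<mu> A] by (rule ennreal_SUP_add_left[symmetric, OF nonempty])
  also have "\<dots> \<le> total_variation \<mu> (A \<union> B)"
  proof (rule SUP_least)
    fix \<A> assume \<A>: "\<A> \<in> ?F A"
    have "?S \<A> + total_variation \<mu> B = (SUP \<B>\<in>?F B. ?S \<A> + ?S \<B>)"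
      unfolding total_variation_def
      by (rule ennreal_SUP_add_right[OF nonempty])
    also have "\<dots> \<le> total_variation \<mu> (A \<union> B)"
      using le[OF \<A>] by (intro SUP_least) auto
    finally show "?S \<A> + total_variation \<mu> B \<le> total_variation \<mu> (A \<union> B)" .
  qed
  finally show ?thesis .
qed

text \<open>Each member of an admissible family for the union is cut along the pieces \<open>A i\<close>; for fixed \<open>i\<close>
the cuts form an admissible family for \<open>A i\<close>.\<close>

lemma total_variation_countably_subadditive:
  assumes \<mu>: "signed_radon_measure \<mu>"
    and A: "range A \<subseteq> sets borel" "disjoint_family A"
  shows "total_variation \<mu> (\<Union>i. A i) \<le> (\<Sum>i. total_variation \<mu> (A i))"
  unfolding total_variation_def[of \<mu> "\<Union>i. A i"]
proof (rule SUP_least)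
  fix \<B>
  assume "\<B> \<in> {\<A>. finite \<A> \<and> disjoint \<A> \<and>
    (\<forall>B\<in>\<A>. B \<in> sets borel \<and> bounded B \<and> B \<subseteq> (\<Union>i. A i))}"
  then have \<B>: "finite \<B>" "disjoint \<B>"
    and \<B>': "\<forall>B\<in>\<B>. B \<in> sets borel \<and> bounded B \<and> B \<subseteq> (\<Union>i. A i)"
    by blast+
  have "(\<Sum>B\<in>\<B>. ennreal \<bar>\<mu> B\<bar>) \<le> (\<Sum>B\<in>\<B>. \<Sum>i. ennreal \<bar>\<mu> (B \<inter> A i)\<bar>)"
  proof (rule sum_mono)
    fix B assume B: "B \<in> \<B>"
    have B_eq: "(\<Union>i. B \<inter> A i) = B" using \<B>' B by blast
    have "disjoint_family (\<lambda>i. B \<inter> A i)"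
      using A(2) unfolding disjoint_family_on_def by blast
    moreover have "bounded (\<Union>i. B \<inter> A i)" "range (\<lambda>i. B \<inter> A i) \<subseteq> sets borel"
      using \<B>' B A(1) by (auto simp: B_eq simp del: UN_simps)
    ultimately show "ennreal \<bar>\<mu> B\<bar> \<le> (\<Sum>i. ennreal \<bar>\<mu> (B \<inter> A i)\<bar>)"
      using abs_signed_measure_le_suminf[OF \<mu>, of "\<lambda>i. B \<inter> A i"] unfolding B_eq by blast
  qed
  also have "\<dots> = (\<Sum>i. \<Sum>B\<in>\<B>. ennreal \<bar>\<mu> (B \<inter> A i)\<bar>)"
    by (rule suminf_sum[symmetric]) auto
  also have "\<dots> \<le> (\<Sum>i. total_variation \<mu> (A i))"
  proof (intro suminf_le allI)
    fix i
    have "(\<Sum>B\<in>\<B>. ennreal \<bar>\<mu> (B \<inter> A i)\<bar>) = (\<Sum>C\<in>(\<lambda>B. B \<inter> A i) ` \<B>. ennreal \<bar>\<mu> C\<bar>)"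
    proof (subst sum.reindex_nontrivial[OF \<B>(1)])
      fix B B' assume "B \<in> \<B>" "B' \<in> \<B>" "B \<noteq> B'" "B \<inter> A i = B' \<inter> A i"
      with \<B>(2) have "B \<inter> A i = {}" by (auto simp: disjoint_def)
      then show "ennreal \<bar>\<mu> (B \<inter> A i)\<bar> = 0" by (simp add: signed_measure_empty[OF \<mu>])
    qed simp
    also have "\<dots> \<le> total_variation \<mu> (A i)"
    proof (rule total_variation_upper)
      show "disjoint ((\<lambda>B. B \<inter> A i) ` \<B>)"
        using \<B>(2) by (fastforce simp: disjoint_def)
    qed (use \<B> \<B>' A(1) in \<open>auto intro: bounded_subset\<close>)
    finally show "(\<Sum>B\<in>\<B>. ennreal \<bar>\<mu> (B \<inter> A i)\<bar>) \<le> total_variation \<mu> (A i)" .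
  qed auto
  finally show "(\<Sum>B\<in>\<B>. ennreal \<bar>\<mu> B\<bar>) \<le> (\<Sum>i. total_variation \<mu> (A i))" .
qed

lemma total_variation_finite_sum_le:
  assumes \<mu>: "signed_radon_measure \<mu>" and "disjoint_family A"
  shows "(\<Sum>i<n::nat. total_variation \<mu> (A i)) \<le> total_variation \<mu> (\<Union>i<n. A i)"
proof (induction n)
  case (Suc n)
  have "(\<Sum>i<Suc n. total_variation \<mu> (A i))
      \<le> total_variation \<mu> (\<Union>i<n. A i) + total_variation \<mu> (A n)"
    using Suc by (simp add: add_right_mono)
  also have "\<dots> \<le> total_variation \<mu> ((\<Union>i<n. A i) \<union> A n)"
  proof (rule total_variation_superadditive[OF \<mu>])
    have "A i \<inter> A n = {}" if "i < n" for i
      using assms(2) that unfolding disjoint_family_on_def by (metis UNIV_I less_irrefl)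
    then show "(\<Union>i<n. A i) \<inter> A n = {}" by blast
  qed
  also have "(\<Union>i<n. A i) \<union> A n = (\<Union>i<Suc n. A i)"
    by (auto simp: lessThan_Suc)
  finally show ?case .
qed simp

lemma total_variation_countably_additive:
  assumes \<mu>: "signed_radon_measure \<mu>"
    and A: "range A \<subseteq> sets borel" "disjoint_family A"
  shows "(\<Sum>i. total_variation \<mu> (A i)) = total_variation \<mu> (\<Union>i. A i)"
proof (rule antisym)
  show "(\<Sum>i. total_variation \<mu> (A i)) \<le> total_variation \<mu> (\<Union>i. A i)"
    unfolding suminf_eq_SUP
    by (intro SUP_least order_trans[OF total_variation_finite_sum_le[OF \<mu> A(2)]]
        total_variation_mono) auto
qed (rule total_variation_countably_subadditive[OF assms])

text \<open>Restricting to a bounded set \<open>K\<close> gives a finite Borel measure, to which the regularity theorems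
apply.\<close>

definition variation_measure :: "('a::euclidean_space set \<Rightarrow> real) \<Rightarrow> 'a set \<Rightarrow> 'a measure" where
  "variation_measure \<mu> K = measure_of UNIV (sets borel) (\<lambda>A. total_variation \<mu> (A \<inter> K))"

lemma sets_variation_measure [simp, measurable_cong]: "sets (variation_measure \<mu> K) = sets borel"
  unfolding variation_measure_def by (metis sets.sets_measure_of_eq space_borel)

lemma space_variation_measure [simp]: "space (variation_measure \<mu> K) = UNIV"
  using sets_eq_imp_space_eq[OF sets_variation_measure] by simp

lemma emeasure_variation_measure:
  assumes \<mu>: "signed_radon_measure \<mu>" and K: "K \<in> sets borel" and A: "A \<in> sets borel"
  shows "emeasure (variation_measure \<mu> K) A = total_variation \<mu> (A \<inter> K)"
proof (rule emeasure_measure_of[OF variation_measure_def])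
  let ?M = "sets (variation_measure \<mu> K)"
  have "total_variation \<mu> {} = 0"
    unfolding total_variation_def using signed_measure_empty[OF \<mu>]
    by (intro antisym SUP_least) (auto intro!: sum.neutral)
  then show "positive ?M (\<lambda>A. total_variation \<mu> (A \<inter> K))"
    by (simp add: positive_def)
  show "countably_additive ?M (\<lambda>A. total_variation \<mu> (A \<inter> K))"
  proof (rule countably_additiveI)
    fix B :: "nat \<Rightarrow> 'a set" assume "range B \<subseteq> ?M" "disjoint_family B"
    then have "(\<Sum>i. total_variation \<mu> (B i \<inter> K)) = total_variation \<mu> (\<Union>i. B i \<inter> K)"
      using K by (intro total_variation_countably_additive[OF \<mu>])
        (auto intro: disjoint_family_on_bisimulation)
    then show "(\<Sum>i. total_variation \<mu> (B i \<inter> K)) = total_variation \<mu> (\<Union>(range B) \<inter> K)"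
      by simp
  qed
qed (use A in auto)

lemma finite_variation_measure:
  assumes \<mu>: "signed_radon_measure \<mu>" and K: "K \<in> sets borel" "bounded K"
  shows "emeasure (variation_measure \<mu> K) UNIV < \<infinity>"
proof -
  have "total_variation \<mu> K \<le> total_variation \<mu> (closure K)"
    by (rule total_variation_mono[OF closure_subset])
  also have "\<dots> < \<infinity>"
    using \<mu> K(2) unfolding signed_radon_measure_def by simp
  finally show ?thesis by (simp add: emeasure_variation_measure[OF \<mu> K(1)])
qed

lemma measure_regular_approximation:
  fixes M :: "'a::{second_countable_topology, complete_space} measure"
  assumes sb: "sets M = sets borel" and fin: "emeasure M (space M) \<noteq> \<infinity>"
    and A: "A \<in> sets borel" and e: "0 < e"
  obtains E V where "compact E" "open V" "E \<subseteq> A" "E \<subseteq> V"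
    "emeasure M (A - E) < ennreal e" "emeasure M (V - E) < ennreal e"
proof -
  have finB: "emeasure M B \<noteq> \<infinity>" for B
    using fin emeasure_space[of M B] by (auto simp: top_unique)
  have A': "A \<in> sets M" using A sb by simp
  obtain E where E: "E \<subseteq> A" "compact E" "emeasure M A < emeasure M E + ennreal e"
  proof -
    have "\<exists>E\<in>{K. K \<subseteq> A \<and> compact K}. emeasure M A < emeasure M E + ennreal e"
    proof (rule ccontr)
      assume "\<not> ?thesis"
      then have *: "emeasure M K + ennreal e \<le> emeasure M A" if "K \<subseteq> A" "compact K" for K
        using that by (auto simp: not_less)
      have "emeasure M A + ennreal e = (SUP K\<in>{K. K \<subseteq> A \<and> compact K}. emeasure M K + ennreal e)"
        unfolding inner_regular[OF sb fin A]
        by (rule ennreal_SUP_add_left[symmetric]) auto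
      also have "\<dots> \<le> emeasure M A" using * by (intro SUP_least) auto
      finally show False
        using e finB[of A] by (cases "emeasure M A") (auto simp flip: ennreal_plus)
    qed
    then show ?thesis using that by auto
  qed
  have E': "E \<in> sets M" using E(2) sb by (simp add: compact_imp_closed)
  obtain V where V: "E \<subseteq> V" "open V" "emeasure M V < emeasure M E + ennreal e"
  proof -
    have "emeasure M E < emeasure M E + ennreal e"
      using e finB[of E]
      by (cases "emeasure M E") (auto simp: ennreal_less_iff simp flip: ennreal_plus)
    then have "\<exists>U\<in>{U. E \<subseteq> U \<and> open U}. emeasure M U < emeasure M E + ennreal e"
      using outer_regular[OF sb fin, of E] E' sb by (metis (no_types, lifting) INF_less_iff)
    then show ?thesis using that by auto
  qed
  have V': "V \<in> sets M" using V(2) sb by simp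
  have diff: "emeasure M (B - E) < ennreal e"
    if "B \<in> sets M" "E \<subseteq> B" "emeasure M B < emeasure M E + ennreal e" for B
    using that finB[of E] E' emeasure_Diff[of M E B] emeasure_mono[OF that(2,1)]
    by (cases "emeasure M E"; cases "emeasure M B")
       (use e in \<open>auto simp: ennreal_minus ennreal_less_iff simp flip: ennreal_plus\<close>)
  show ?thesis
    using that[OF E(2) V(2) E(1) V(1)] diff[OF A' E(1) E(3)] diff[OF V' V(1) V(3)] by blast
qed

section \<open>Decay of the content of superlevel sets\<close>

text \<open>If \<open>t * H {f > t} \<ge> e\<close> held for all large \<open>t\<close>, the Choquet integral would dominate
\<open>\<integral> e / t dt = \<infinity>\<close>. Monotonicity of the integral extends to non-measurable integrands, which
is what makes this comparison legitimate for an arbitrary set function \<open>H\<close>.\<close>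

lemma choquet_integral_finite_imp_small:
  assumes fin: "choquet_integral H Q f < \<infinity>" and T: "0 < T" and e: "0 < e"
  obtains t where "T \<le> t" "ennreal t * H {x \<in> Q. ennreal t < f x} < ennreal e"
proof -
  have "\<exists>t\<ge>T. ennreal t * H {x \<in> Q. ennreal t < f x} < ennreal e"
  proof (rule ccontr)
    assume "\<not> ?thesis"
    then have big: "ennreal e \<le> ennreal t * H {x \<in> Q. ennreal t < f x}" if "T \<le> t" for t
      using that by (auto simp: not_less)
    have large: "ennreal (e * real n) \<le> choquet_integral H Q f" for n
    proof -
      \<comment> \<open>\<open>\<integral> e / t dt\<close> over \<open>[T, ?b]\<close> is exactly \<open>e n\<close>\<close>
      let ?b = "T * exp (real n)"
      have Tb: "T \<le> ?b" using T by simp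
      have "(\<integral>\<^sup>+t. ennreal (e / t) * indicator {T..?b} t \<partial>lborel)
          = ennreal (e * ln ?b - e * ln T)"
      proof (rule nn_integral_FTC_Icc[OF _ _ _ Tb])
        show "((\<lambda>t. e * ln t) has_real_derivative e / t) (at t)"
          if "t \<in> {T..?b}" for t
          using that T by (auto intro!: derivative_eq_intros simp: divide_inverse)
      qed (use T e in auto)
      also have "e * ln ?b - e * ln T = e * real n"
        using T by (simp add: ln_mult algebra_simps)
      finally have "ennreal (e * real n) = (\<integral>\<^sup>+t. ennreal (e / t) * indicator {T..?b} t \<partial>lborel)" ..
      also have "\<dots> \<le> choquet_integral H Q f"
        unfolding choquet_integral_def
      proof (rule nn_integral_mono)
        fix t :: real
        show "ennreal (e / t) * indicator {T..?b} t
            \<le> H {x \<in> Q. ennreal t < f x} * indicator {0..} t"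
        proof (cases "t \<in> {T..?b}")
          case True
          then have t: "0 < t" "T \<le> t" using T by auto
          have "ennreal (e / t) = ennreal (1 / t) * ennreal e"
            using t e by (simp flip: ennreal_mult)
          also have "\<dots> \<le> ennreal (1 / t) * (ennreal t * H {x \<in> Q. ennreal t < f x})"
            by (rule mult_left_mono[OF big[OF t(2)]]) simp
          also have "\<dots> = H {x \<in> Q. ennreal t < f x}"
            using t by (simp add: mult.assoc[symmetric] flip: ennreal_mult)
          finally show ?thesis using True t by simp
        qed simp
      qed
      finally show ?thesis .
    qed
    obtain n :: nat where "choquet_integral H Q f < ennreal (e * real n)"
    proof (cases "choquet_integral H Q f")
      case (real r)
      obtain n :: nat where "r / e < real n" using reals_Archimedean2 by blast
      then have "r < e * real n" using e by (simp add: pos_divide_less_eq mult.commute)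
      then show ?thesis using that real by (simp add: ennreal_less_iff)
    qed (use fin in simp)
    with large[of n] show False by simp
  qed
  then show ?thesis using that by blast
qed

section \<open>Covers by grid cubes\<close>

text \<open>The generation is the coarsest one with mesh at most \<open>\<rho>\<close>. Its mesh exceeds \<open>\<rho> / 2\<close> unless it is
generation 0, where \<open>S\<close> lies in a single cube; either way the floors of the coordinates of points
of \<open>S\<close> take at most five values in each direction.\<close>

lemma small_set_grid_cover:
  fixes S :: "'a::euclidean_space set"
  assumes l: "0 < l" and \<beta>: "0 < \<beta>" and S: "S \<subseteq> grid_cube c l 0 x0"
    and \<rho>: "0 < \<rho>" and diam: "\<And>x y. x \<in> S \<Longrightarrow> y \<in> S \<Longrightarrow> dist x y \<le> \<rho>"
  obtains P where "finite P" "S \<subseteq> (\<Union>(k, y)\<in>P. grid_cube c l k y)"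
    "emeasure (cost l \<beta>) P \<le> ennreal (5 ^ DIM('a) * \<rho> powr \<beta>)"
proof (cases "S = {}")
  case True
  then show ?thesis using that[of "{}"] by (simp add: emeasure_cost)
next
  case False
  then obtain x where x: "x \<in> S" by blast
  define k where "k = (LEAST k. mesh l k \<le> \<rho>)"
  have "\<exists>k. mesh l k \<le> \<rho>"
  proof -
    obtain k where "(1/2) ^ k < \<rho> / l"
      using real_arch_pow_inv[of "\<rho> / l" "1/2"] l \<rho> by auto
    then have "mesh l k \<le> \<rho>"
      using l by (simp add: mesh_def field_simps)
    then show ?thesis ..
  qed
  then have k: "mesh l k \<le> \<rho>" unfolding k_def by (rule LeastI_ex)
  let ?s = "mesh l k"
  have s: "0 < ?s" using mesh_pos[OF l] .
  define F where "F = (\<lambda>z. \<lambda>b\<in>Basis. \<lfloor>(z - c) \<bullet> b / ?s\<rfloor>)"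
  have F_b: "F z b = \<lfloor>(z - c) \<bullet> b / ?s\<rfloor>" if "b \<in> Basis" for z b
    using that by (simp add: F_def)
  let ?B = "\<Pi>\<^sub>E b\<in>Basis. {F x b - 2..F x b + 2}"
  have F_in: "F z \<in> ?B" if z: "z \<in> S" for z
  proof (rule PiE_I)
    fix b :: 'a assume b: "b \<in> Basis"
    show "F z b \<in> {F x b - 2..F x b + 2}"
    proof (cases k)
      case 0
      have "z \<in> grid_cube c l k x"
        using z x S 0 grid_cube_eq[of x c l 0 x0] by blast
      then have "F z b = F x b" using b by (simp add: F_def grid_cube_def)
      then show ?thesis by simp
    next
      case (Suc i)
      then have "\<not> mesh l i \<le> \<rho>"
        using not_less_Least[of i "\<lambda>k. mesh l k \<le> \<rho>"] by (simp add: k_def)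
      then have "\<rho> < 2 * ?s" using mesh_Suc[of l i] Suc by simp
      moreover have "\<bar>(z - x) \<bullet> b\<bar> \<le> \<rho>"
        using Basis_le_norm[OF b, of "z - x"] diam[OF z x] by (simp add: dist_norm)
      ultimately have "\<bar>(z - x) \<bullet> b\<bar> < 2 * ?s" by simp
      then have "\<bar>(z - c) \<bullet> b / ?s - (x - c) \<bullet> b / ?s\<bar> < 2"
        using s by (simp add: inner_diff_left pos_divide_less_eq flip: diff_divide_distrib)
      then show ?thesis using b by (simp add: F_def) linarith
    qed
  qed (simp add: F_def)
  have finB: "finite ?B" by (intro finite_PiE) auto
  have cardB: "card ?B = 5 ^ DIM('a)" by (simp add: card_PiE)
  have sub: "F ` S \<subseteq> ?B" using F_in by blast
  define Y where "Y = inv_into S F ` F ` S"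
  have finY: "finite Y" unfolding Y_def using finite_subset[OF sub finB] by blast
  have "card Y \<le> card (F ` S)"
    unfolding Y_def by (intro card_image_le finite_subset[OF sub finB])
  also have "\<dots> \<le> 5 ^ DIM('a)" using card_mono[OF finB sub] cardB by simp
  finally have cardY: "card Y \<le> 5 ^ DIM('a)" .
  show ?thesis
  proof (rule that[of "{k} \<times> Y"])
    show "S \<subseteq> (\<Union>(k, y)\<in>{k} \<times> Y. grid_cube c l k y)"
    proof
      fix z assume z: "z \<in> S"
      let ?y = "inv_into S F (F z)"
      have "F ?y = F z" using z by (simp add: f_inv_into_f)
      then have "\<lfloor>(z - c) \<bullet> b / ?s\<rfloor> = \<lfloor>(?y - c) \<bullet> b / ?s\<rfloor>" if "b \<in> Basis" for b
        using F_b[OF that, of z] F_b[OF that, of ?y] by simp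
      then have "z \<in> grid_cube c l k ?y" by (simp add: grid_cube_def)
      moreover have "?y \<in> Y" using z by (simp add: Y_def)
      ultimately show "z \<in> (\<Union>(k, y)\<in>{k} \<times> Y. grid_cube c l k y)" by auto
    qed
    have "emeasure (cost l \<beta>) ({k} \<times> Y) = (\<Sum>p\<in>{k} \<times> Y. ennreal (mesh l (fst p) powr \<beta>))"
      using finY by (simp add: emeasure_cost nn_integral_count_space_finite)
    also have "\<dots> = (\<Sum>p\<in>{k} \<times> Y. ennreal (?s powr \<beta>))"
      by (rule sum.cong) auto
    also have "\<dots> = ennreal (real (card Y) * ?s powr \<beta>)"
      by (simp add: card_cartesian_product ennreal_mult ennreal_of_nat_eq_real_of_nat)
    also have "\<dots> \<le> ennreal (5 ^ DIM('a) * \<rho> powr \<beta>)"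
    proof (intro ennreal_leI mult_mono powr_mono2)
      show "real (card Y) \<le> 5 ^ DIM('a)"
        using cardY by (metis of_nat_le_iff of_nat_numeral of_nat_power)
    qed (use k s \<beta> in auto)
    finally show "emeasure (cost l \<beta>) ({k} \<times> Y) \<le> ennreal (5 ^ DIM('a) * \<rho> powr \<beta>)" .
  qed (use finY in simp)
qed

text \<open>The diameter bounds may vanish (for single points), so each is enlarged to a positive one, at
the total price \<open>e\<close>.\<close>

lemma countable_grid_cover:
  fixes S :: "nat \<Rightarrow> 'a::euclidean_space set"
  assumes l: "0 < l" and \<beta>: "0 < \<beta>" and e: "0 < e"
    and d: "\<And>i. 0 \<le> d i" "\<And>i x y. x \<in> S i \<Longrightarrow> y \<in> S i \<Longrightarrow> dist x y \<le> d i"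
  obtains P where "countable P" "(\<Union>i. S i) \<inter> grid_cube c l 0 x0 \<subseteq> (\<Union>(k, y)\<in>P. grid_cube c l k y)"
    "emeasure (cost l \<beta>) P \<le> ennreal (5 ^ DIM('a)) * ((\<Sum>i. ennreal (d i powr \<beta>)) + ennreal e)"
proof -
  define \<rho> where "\<rho> i = (d i powr \<beta> + e * (1/2) ^ Suc i) powr (1 / \<beta>)" for i
  have pos: "0 < d i powr \<beta> + e * (1/2) ^ Suc i" for i
    using e by (intro add_nonneg_pos) auto
  have \<rho>_pos: "0 < \<rho> i" for i
    using pos[of i] by (simp add: \<rho>_def)
  have \<rho>_powr: "\<rho> i powr \<beta> = d i powr \<beta> + e * (1/2) ^ Suc i" for i
    using \<beta> pos[of i] by (simp add: \<rho>_def powr_powr)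
  have d_le: "d i \<le> \<rho> i" for i
  proof (rule ccontr)
    assume "\<not> d i \<le> \<rho> i"
    then have "\<rho> i powr \<beta> < d i powr \<beta>"
      using \<rho>_pos[of i] \<beta> by (intro powr_less_mono2) auto
    moreover have "0 < e * (1/2) ^ Suc i" using e by simp
    ultimately show False using \<rho>_powr[of i] by linarith
  qed
  have "\<exists>P. finite P \<and> S i \<inter> grid_cube c l 0 x0 \<subseteq> (\<Union>(k, y)\<in>P. grid_cube c l k y) \<and>
      emeasure (cost l \<beta>) P \<le> ennreal (5 ^ DIM('a) * \<rho> i powr \<beta>)" for i
  proof -
    have "dist x y \<le> \<rho> i" if "x \<in> S i \<inter> grid_cube c l 0 x0" "y \<in> S i \<inter> grid_cube c l 0 x0" for x y
      using d(2)[of x i y] d_le[of i] that by simp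
    then show ?thesis
      using small_set_grid_cover[OF l \<beta> inf_le2 \<rho>_pos[of i]] by metis
  qed
  then obtain P where P: "\<And>i. finite (P i)"
      "\<And>i. S i \<inter> grid_cube c l 0 x0 \<subseteq> (\<Union>(k, y)\<in>P i. grid_cube c l k y)"
      "\<And>i. emeasure (cost l \<beta>) (P i) \<le> ennreal (5 ^ DIM('a) * \<rho> i powr \<beta>)"
    by metis
  show ?thesis
  proof (rule that[of "\<Union>i. P i"])
    show "countable (\<Union>i. P i)" using P(1) by (simp add: countable_finite)
    show "(\<Union>i. S i) \<inter> grid_cube c l 0 x0 \<subseteq> (\<Union>(k, y)\<in>(\<Union>i. P i). grid_cube c l k y)"
      using P(2) by blast
    have geom: "(\<Sum>i. ennreal (e * (1/2) ^ Suc i)) = ennreal e"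
      using sums_mult[OF power_half_series, of e] e by (subst suminf_ennreal_eq) auto
    have "emeasure (cost l \<beta>) (\<Union>i. P i) \<le> (\<Sum>i. emeasure (cost l \<beta>) (P i))"
      by (intro emeasure_subadditive_countably) auto
    also have "\<dots> \<le> (\<Sum>i. ennreal (5 ^ DIM('a)) * (ennreal (d i powr \<beta>) + ennreal (e * (1/2) ^ Suc i)))"
      using P(3) e by (intro suminf_le) (auto simp: \<rho>_powr ennreal_mult ennreal_plus simp del: power_Suc)
    also have "\<dots> = ennreal (5 ^ DIM('a)) * ((\<Sum>i. ennreal (d i powr \<beta>)) + ennreal e)"
      by (simp add: suminf_add[symmetric] geom del: power_Suc)
    finally show "emeasure (cost l \<beta>) (\<Union>i. P i)
      \<le> ennreal (5 ^ DIM('a)) * ((\<Sum>i. ennreal (d i powr \<beta>)) + ennreal e)" .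
  qed
qed

lemma hausdorff_content_grid_cover:
  fixes G :: "'a::euclidean_space set"
  assumes l: "0 < l" and \<beta>: "0 < \<beta>" and e: "0 < e" and G: "G \<subseteq> grid_cube c l 0 x0"
    and H: "hausdorff_content \<beta> G < ennreal a"
  obtains P where "countable P" "G \<subseteq> (\<Union>(k, y)\<in>P. grid_cube c l k y)"
    "emeasure (cost l \<beta>) P \<le> ennreal (5 ^ DIM('a) * (2 powr \<beta> / unit_ball_vol \<beta> * a + e))"
proof -
  have a: "0 < a"
    using H by (metis ennreal_neg linorder_not_less not_less_zero)
  define w where "w = unit_ball_vol \<beta>"
  have w: "0 < w" using \<beta> by (simp add: w_def)
  obtain x r where r: "\<And>i. 0 \<le> r i" and cov: "G \<subseteq> (\<Union>i::nat. ball (x i) (r i))"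
    and sum: "(\<Sum>i. ennreal (w * r i powr \<beta>)) < ennreal a"
    using H unfolding hausdorff_content_def w_def Inf_less_iff by blast
  have "(\<Sum>i. ennreal ((2 * r i) powr \<beta>)) = (\<Sum>i. ennreal (2 powr \<beta> / w) * ennreal (w * r i powr \<beta>))"
    using w r by (intro suminf_cong) (simp add: powr_mult flip: ennreal_mult)
  also have "\<dots> \<le> ennreal (2 powr \<beta> / w) * ennreal a"
    using sum by (simp add: mult_left_mono)
  finally have le: "(\<Sum>i. ennreal ((2 * r i) powr \<beta>)) \<le> ennreal (2 powr \<beta> / w * a)"
    using a w by (simp flip: ennreal_mult)
  obtain P where P: "countable P"
    "(\<Union>i. ball (x i) (r i)) \<inter> grid_cube c l 0 x0 \<subseteq> (\<Union>(k, y)\<in>P. grid_cube c l k y)"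
    "emeasure (cost l \<beta>) P
      \<le> ennreal (5 ^ DIM('a)) * ((\<Sum>i. ennreal ((2 * r i) powr \<beta>)) + ennreal e)"
  proof (rule countable_grid_cover[OF l \<beta> e, of "\<lambda>i. 2 * r i" "\<lambda>i. ball (x i) (r i)" c x0])
    fix i u v assume "u \<in> ball (x i) (r i)" "v \<in> ball (x i) (r i)"
    then show "dist u v \<le> 2 * r i"
      using dist_triangle3[of u v "x i"] by simp
  qed (use r in auto)
  have "emeasure (cost l \<beta>) P \<le> ennreal (5 ^ DIM('a)) * (ennreal (2 powr \<beta> / w * a) + ennreal e)"
    using P(3) by (rule order_trans) (intro mult_left_mono add_right_mono le, simp)
  also have "\<dots> = ennreal (5 ^ DIM('a) * (2 powr \<beta> / w * a + e))"
    using a e w by (simp add: ennreal_mult ennreal_plus)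
  finally have "emeasure (cost l \<beta>) P \<le> ennreal (5 ^ DIM('a) * (2 powr \<beta> / w * a + e))" .
  moreover have "G \<subseteq> (\<Union>(k, y)\<in>P. grid_cube c l k y)"
    by (rule order_trans[OF Int_greatest[OF cov G] P(2)])
  ultimately show ?thesis
    using that[OF P(1)] by (simp add: w_def)
qed

lemma hausdorff_null_grid_cover:
  fixes A :: "'a::euclidean_space set"
  assumes l: "0 < l" and \<beta>: "0 < \<beta>" and e: "0 < e" and A: "A \<subseteq> grid_cube c l 0 x0"
    and H: "hausdorff_measure \<beta> A = 0"
  obtains P where "countable P" "A \<subseteq> (\<Union>(k, y)\<in>P. grid_cube c l k y)"
    "emeasure (cost l \<beta>) P \<le> ennreal (5 ^ DIM('a) * e)"
proof -
  define w where "w = unit_ball_vol \<beta>"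
  have w: "0 < w" using \<beta> by (simp add: w_def)
  \<comment> \<open>the premeasure weighs a set by \<open>w (diameter / 2)\<^sup>\<beta>\<close>, the cost by \<open>diameter\<^sup>\<beta>\<close>\<close>
  define h where "h = w * (e / 2) / 2 powr \<beta>"
  have h: "0 < h" using w e by (simp add: h_def)
  have "hausdorff_premeasure \<beta> 1 A \<le> hausdorff_measure \<beta> A"
    unfolding hausdorff_measure_def by (rule SUP_upper) simp
  then have "hausdorff_premeasure \<beta> 1 A < ennreal h" using H h by simp
  then obtain B where B: "\<And>i. bounded (B i)" and cov: "A \<subseteq> (\<Union>i::nat. B i)"
    and sum: "(\<Sum>i. ennreal (w * (diameter (B i) / 2) powr \<beta>)) < ennreal h"
    unfolding hausdorff_premeasure_def w_def Inf_less_iff by blast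
  have "(\<Sum>i. ennreal (diameter (B i) powr \<beta>))
      = (\<Sum>i. ennreal (2 powr \<beta> / w) * ennreal (w * (diameter (B i) / 2) powr \<beta>))"
    using w B by (intro suminf_cong) (simp add: powr_divide diameter_ge_0 flip: ennreal_mult)
  also have "\<dots> \<le> ennreal (2 powr \<beta> / w) * ennreal h"
    using sum by (simp add: mult_left_mono)
  also have "\<dots> = ennreal (e / 2)"
    using w e h by (simp add: h_def flip: ennreal_mult)
  finally have le: "(\<Sum>i. ennreal (diameter (B i) powr \<beta>)) \<le> ennreal (e / 2)" .
  have e2: "0 < e / 2" using e by simp
  obtain P where P: "countable P"
    "(\<Union>i. B i) \<inter> grid_cube c l 0 x0 \<subseteq> (\<Union>(k, y)\<in>P. grid_cube c l k y)"
    "emeasure (cost l \<beta>) P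
      \<le> ennreal (5 ^ DIM('a)) * ((\<Sum>i. ennreal (diameter (B i) powr \<beta>)) + ennreal (e / 2))"
    by (rule countable_grid_cover[OF l \<beta> e2, of "\<lambda>i. diameter (B i)" B c x0])
       (use B in \<open>auto intro: diameter_bounded_bound diameter_ge_0\<close>)
  have "emeasure (cost l \<beta>) P \<le> ennreal (5 ^ DIM('a)) * (ennreal (e / 2) + ennreal (e / 2))"
    using P(3) by (rule order_trans) (intro mult_left_mono add_right_mono le, simp)
  also have "\<dots> = ennreal (5 ^ DIM('a) * e)"
    using e by (simp add: ennreal_mult flip: ennreal_plus)
  finally show ?thesis
    by (rule that[OF P(1) order_trans[OF Int_greatest[OF cov A] P(2)]])
qed

section \<open>Stopping cubes\<close>

lemma countable_grid_cubes: "countable (range (grid_cube c l k))"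
proof (rule countable_subset)
  show "range (grid_cube c l k)
    \<subseteq> (\<lambda>f. {y. \<forall>b\<in>Basis. \<lfloor>(y - c) \<bullet> b / mesh l k\<rfloor> = f b}) ` (\<Pi>\<^sub>E b\<in>Basis. (UNIV :: int set))"
  proof clarify
    fix x
    show "grid_cube c l k x
      \<in> (\<lambda>f. {y. \<forall>b\<in>Basis. \<lfloor>(y - c) \<bullet> b / mesh l k\<rfloor> = f b}) ` (\<Pi>\<^sub>E b\<in>Basis. (UNIV :: int set))"
      by (rule image_eqI[of _ _ "\<lambda>b\<in>Basis. \<lfloor>(x - c) \<bullet> b / mesh l k\<rfloor>"]) (auto simp: grid_cube_def)
  qed
qed (intro countable_image countable_PiE; simp)

lemma grid_cube_subset_maximal_superlevel:
  fixes \<mu> :: "'a::euclidean_space set \<Rightarrow> real"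
  assumes l: "0 < l" and t: "0 \<le> t" and big: "t * mesh l k powr \<beta> < \<bar>\<mu> (grid_cube c l k x)\<bar>"
    and y: "y \<in> grid_cube c l k x"
  shows "ennreal t < dyadic_frac_maximal (real DIM('a) - \<beta>) (cube c l) \<mu> y"
proof -
  let ?Q = "grid_cube c l k x"
  have "t < \<bar>\<mu> ?Q\<bar> / mesh l k powr \<beta>"
    using big mesh_pos[OF l, of k] by (simp add: pos_less_divide_eq)
  then have "ennreal t < ennreal (\<bar>\<mu> ?Q\<bar> / mesh l k powr \<beta>)"
    using t by (simp add: ennreal_less_iff)
  also have "\<dots> = indicator ?Q y *
      ennreal (\<bar>\<mu> ?Q\<bar> / side_length ?Q powr (real DIM('a) - (real DIM('a) - \<beta>)))"
    using y l by (simp add: side_length_grid_cube)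
  also have "\<dots> \<le> dyadic_frac_maximal (real DIM('a) - \<beta>) (cube c l) \<mu> y"
    unfolding dyadic_frac_maximal_def by (intro SUP_upper grid_cube_in_dyadic_cubes l)
  finally show ?thesis .
qed

text \<open>In the stopping-time argument \<open>S\<close> is a cube of generation \<open>k\<close>. The first condition controls the
measure of \<open>S\<close>; the second charges its side to the members of \<open>P\<close> located in \<open>S\<close>, so that
disjoint such cubes have total cost at most \<open>2\<^sup>\<beta>\<close> times that of \<open>P\<close>.\<close>

definition stopping_cube ::
  "real \<Rightarrow> real \<Rightarrow> real \<Rightarrow> ('a::euclidean_space set \<Rightarrow> real) \<Rightarrow> (nat \<times> 'a) set \<Rightarrow>
    nat \<Rightarrow> 'a set \<Rightarrow> bool" where
  "stopping_cube l \<beta> t \<mu> P k S \<longleftrightarrow>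
    \<bar>\<mu> S\<bar> \<le> t * mesh l k powr \<beta> \<and>
    ennreal (mesh l k powr \<beta>) \<le> ennreal (2 powr \<beta>) * emeasure (cost l \<beta>) (P \<inter> UNIV \<times> S)"

text \<open>Descend from generation 0 towards \<open>x\<close>, and call a cube \<open>S\<close> heavy if
\<open>\<bar>\<mu> S\<bar> > t * side(S)\<^sup>\<beta>\<close>. If a member of \<open>P\<close> is met before the first heavy cube, it is itself a stopping cube.
Otherwise the stopping cube is the parent of the first heavy cube: the parent is not heavy, and
the heavy cube, being covered by members of \<open>P\<close> of which none is larger, has side bounded by the
cost of the members inside it. The factor \<open>2\<^sup>\<beta>\<close> pays for the passage to the parent.\<close>

lemma stopping_cube_exists:
  fixes x :: "'a::euclidean_space"
  assumes l: "0 < l" and \<beta>: "0 < \<beta>" "\<beta> \<le> real DIM('a)"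
    and P: "countable P" and x: "x \<in> (\<Union>(k, y)\<in>P. grid_cube c l k y)"
    and top: "\<bar>\<mu> (grid_cube c l 0 x)\<bar> \<le> t * l powr \<beta>"
    and cov: "\<And>j. t * mesh l j powr \<beta> < \<bar>\<mu> (grid_cube c l j x)\<bar> \<Longrightarrow>
      grid_cube c l j x \<subseteq> (\<Union>(k, y)\<in>P. grid_cube c l k y)"
  shows "\<exists>k. stopping_cube l \<beta> t \<mu> P k (grid_cube c l k x)"
proof -
  let ?C = "grid_cube c l"
  let ?big = "\<lambda>j. t * mesh l j powr \<beta> < \<bar>\<mu> (?C j x)\<bar>"
  have unselected: "stopping_cube l \<beta> t \<mu> P k (?C k x)"
    if "\<not> ?big k" "(k, y) \<in> P" "y \<in> ?C k x" for k y
  proof -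
    have "ennreal (mesh l k powr \<beta>) = emeasure (cost l \<beta>) {(k, y)}"
      by (simp add: emeasure_cost_single)
    also have "\<dots> \<le> emeasure (cost l \<beta>) (P \<inter> UNIV \<times> ?C k x)"
      using that by (intro emeasure_cost_mono) auto
    also have "\<dots> = ennreal 1 * emeasure (cost l \<beta>) (P \<inter> UNIV \<times> ?C k x)" by simp
    also have "\<dots> \<le> ennreal (2 powr \<beta>) * emeasure (cost l \<beta>) (P \<inter> UNIV \<times> ?C k x)"
      using \<beta> by (intro mult_right_mono ennreal_leI) (auto intro: ge_one_powr_ge_zero)
    finally show ?thesis
      using that(1) by (simp add: stopping_cube_def)
  qed
  obtain k y where ky: "(k, y) \<in> P" "y \<in> ?C k x"
    using x by (auto simp: grid_cube_sym)
  show ?thesis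
  proof (cases "\<exists>j. ?big j")
    case False
    then show ?thesis using unselected[OF _ ky] by blast
  next
    case True
    define j where "j = (LEAST j. ?big j)"
    have j: "?big j" unfolding j_def using True by (rule LeastI_ex)
    have less: "\<not> ?big i" if "i < j" for i
      using that not_less_Least unfolding j_def by blast
    have "j \<noteq> 0" using j top by (intro notI) simp
    then obtain i where i: "j = Suc i" using not0_implies_Suc by blast
    show ?thesis
    proof (cases "\<exists>k y. (k, y) \<in> P \<and> k \<le> i \<and> y \<in> ?C k x")
      case True
      then obtain k y where "(k, y) \<in> P" "k < j" "y \<in> ?C k x" using i by auto
      then show ?thesis using unselected[OF less] by blast
    next
      case False
      let ?P' = "{p \<in> P. j \<le> fst p \<and> snd p \<in> ?C j x}"
      have "?C j x \<subseteq> (\<Union>(k, y)\<in>?P'. ?C k y)"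
      proof
        fix z assume z: "z \<in> ?C j x"
        then obtain k y where k: "(k, y) \<in> P" "z \<in> ?C k y"
          using cov[OF j] by blast
        have "j \<le> k"
        proof (rule ccontr)
          assume "\<not> j \<le> k"
          then have "k \<le> i" "k \<le> j" using i by auto
          have "z \<in> ?C k x" using grid_cube_antimono[OF \<open>k \<le> j\<close>] z by blast
          then have "y \<in> ?C k x"
            using k(2) grid_cube_eq[of z c l k x] grid_cube_eq[of z c l k y] by (metis mem_grid_cube_self)
          with False k(1) \<open>k \<le> i\<close> show False by blast
        qed
        have "y \<in> ?C k z" using k(2) by (simp add: grid_cube_sym)
        then have "y \<in> ?C j z" using grid_cube_antimono[OF \<open>j \<le> k\<close>] by blast
        then have "y \<in> ?C j x" using grid_cube_eq[OF z] by simp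
        then show "z \<in> (\<Union>(k, y)\<in>?P'. ?C k y)" using k \<open>j \<le> k\<close> by force
      qed
      then have "ennreal (mesh l j powr \<beta>) \<le> emeasure (cost l \<beta>) ?P'"
        using P by (intro mesh_powr_le_cost_of_cover[OF l \<beta>(2)]) auto
      also have "\<dots> \<le> emeasure (cost l \<beta>) (P \<inter> UNIV \<times> ?C i x)"
        using grid_cube_antimono[of i j c l x] i by (intro emeasure_cost_mono) auto
      finally have le: "ennreal (mesh l j powr \<beta>) \<le> emeasure (cost l \<beta>) (P \<inter> UNIV \<times> ?C i x)" .
      have "ennreal (mesh l i powr \<beta>) = ennreal (2 powr \<beta>) * ennreal (mesh l j powr \<beta>)"
        using mesh_pos[OF l, of j] by (simp add: mesh_Suc[of l i] i powr_mult flip: ennreal_mult)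
      also have "\<dots> \<le> ennreal (2 powr \<beta>) * emeasure (cost l \<beta>) (P \<inter> UNIV \<times> ?C i x)"
        by (rule mult_left_mono[OF le]) simp
      finally show ?thesis
        using less[of i] i by (intro exI[of _ i]) (simp add: stopping_cube_def)
    qed
  qed
qed

text \<open>Choosing for each point the coarsest stopping cube makes the chosen cubes pairwise equal or
disjoint, because being a stopping cube depends on the cube and its generation only.\<close>

lemma stopping_cubes_union_bound:
  fixes \<mu> :: "'a::euclidean_space set \<Rightarrow> real"
  assumes \<mu>: "signed_radon_measure \<mu>" and l: "0 < l" and t: "0 \<le> t"
    and E: "E \<subseteq> grid_cube c l 0 x0"
    and ex: "\<And>x. x \<in> E \<Longrightarrow> \<exists>k. stopping_cube l \<beta> t \<mu> P k (grid_cube c l k x)"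
  obtains U where "E \<subseteq> U" "U \<in> sets borel" "U \<subseteq> grid_cube c l 0 x0"
    "\<And>u. u \<in> U \<Longrightarrow> \<exists>x\<in>E. \<exists>k. stopping_cube l \<beta> t \<mu> P k (grid_cube c l k x) \<and> u \<in> grid_cube c l k x"
    "ennreal \<bar>\<mu> U\<bar> \<le> ennreal (t * 2 powr \<beta>) * emeasure (cost l \<beta>) P"
proof -
  let ?C = "grid_cube c l" and ?W = "emeasure (cost l \<beta>)"
  define m where "m x = (LEAST k. stopping_cube l \<beta> t \<mu> P k (?C k x))" for x
  have m: "stopping_cube l \<beta> t \<mu> P (m x) (?C (m x) x)" if "x \<in> E" for x
    unfolding m_def using ex[OF that] by (rule LeastI_ex)
  have m_le: "m x \<le> k" if "stopping_cube l \<beta> t \<mu> P k (?C k x)" for x k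
    unfolding m_def using that by (rule Least_le)
  define \<D> where "\<D> = (\<lambda>x. ?C (m x) x) ` E"
  have nested: "?C (m x) x = ?C (m y) y"
    if xy: "x \<in> E" "y \<in> E" "m x \<le> m y" "z \<in> ?C (m x) x" "z \<in> ?C (m y) y" for x y z
  proof -
    have "y \<in> ?C (m y) z" using xy(5) by (simp add: grid_cube_sym)
    then have "y \<in> ?C (m x) z" using grid_cube_antimono[OF xy(3)] by blast
    then have eq: "?C (m x) y = ?C (m x) x"
      using grid_cube_eq[of y c l "m x" z] grid_cube_eq[OF xy(4)] by simp
    then have "m y \<le> m x" using m[OF xy(1)] by (intro m_le) simp
    with xy(3) eq show ?thesis by simp
  qed
  have disj: "disjoint \<D>"
  proof (rule disjointI)
    fix S T assume "S \<in> \<D>" "T \<in> \<D>" "S \<noteq> T"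
    then obtain x y where xy: "x \<in> E" "y \<in> E" "S = ?C (m x) x" "T = ?C (m y) y"
      by (auto simp: \<D>_def)
    show "S \<inter> T = {}"
    proof (rule ccontr)
      assume "S \<inter> T \<noteq> {}"
      then obtain z where "z \<in> S" "z \<in> T" by blast
      then show False
        using nested[of x y z] nested[of y x z] xy \<open>S \<noteq> T\<close> by (metis linear)
    qed
  qed
  have count: "countable \<D>"
  proof (rule countable_subset)
    show "\<D> \<subseteq> (\<Union>k. range (?C k))" by (auto simp: \<D>_def)
  qed (simp add: countable_grid_cubes)
  have borel: "\<D> \<subseteq> sets borel" using l by (auto simp: \<D>_def)
  have sub: "\<Union>\<D> \<subseteq> ?C 0 x0"
  proof
    fix z assume "z \<in> \<Union>\<D>"
    then obtain x where x: "x \<in> E" "z \<in> ?C (m x) x" by (auto simp: \<D>_def)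
    have "z \<in> ?C 0 x" using grid_cube_antimono[of 0 "m x" c l x] x(2) by blast
    then show "z \<in> ?C 0 x0" using grid_cube_eq[of x c l 0 x0] E x(1) by blast
  qed
  have U_borel: "\<Union>\<D> \<in> sets borel"
    using sets.countable_Union[OF count borel] .
  have bnd: "bounded (\<Union>\<D>)"
    by (rule bounded_subset[OF bounded_grid_cube[OF l] sub])
  show ?thesis
  proof (rule that[of "\<Union>\<D>"])
    show "E \<subseteq> \<Union>\<D>" by (auto simp: \<D>_def)
    show "\<exists>x\<in>E. \<exists>k. stopping_cube l \<beta> t \<mu> P k (?C k x) \<and> u \<in> ?C k x" if "u \<in> \<Union>\<D>" for u
      using that m by (auto simp: \<D>_def)
    have "ennreal \<bar>\<mu> (\<Union>\<D>)\<bar> \<le> (\<integral>\<^sup>+S. ennreal \<bar>\<mu> (\<Union>\<D> \<inter> S)\<bar> \<partial>count_space \<D>)"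
      by (rule abs_signed_measure_le_partition[OF \<mu> count disj borel U_borel bnd]) simp
    also have "\<dots> \<le> (\<integral>\<^sup>+S. ennreal (t * 2 powr \<beta>) * ?W (P \<inter> UNIV \<times> S) \<partial>count_space \<D>)"
    proof (rule nn_integral_mono)
      fix S assume "S \<in> space (count_space \<D>)"
      then have S: "S \<in> \<D>" by simp
      then obtain x where x: "x \<in> E" "S = ?C (m x) x" by (auto simp: \<D>_def)
      have "\<Union>\<D> \<inter> S = S" using S by blast
      then have "ennreal \<bar>\<mu> (\<Union>\<D> \<inter> S)\<bar> \<le> ennreal (t * mesh l (m x) powr \<beta>)"
        using m[OF x(1)] x(2) by (auto simp: stopping_cube_def intro: ennreal_leI)
      also have "\<dots> = ennreal t * ennreal (mesh l (m x) powr \<beta>)"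
        using t by (simp add: ennreal_mult)
      also have "\<dots> \<le> ennreal t * (ennreal (2 powr \<beta>) * ?W (P \<inter> UNIV \<times> S))"
        using m[OF x(1)] x(2) by (intro mult_left_mono) (auto simp: stopping_cube_def)
      also have "\<dots> = ennreal (t * 2 powr \<beta>) * ?W (P \<inter> UNIV \<times> S)"
        using t by (simp add: ennreal_mult mult.assoc)
      finally show "ennreal \<bar>\<mu> (\<Union>\<D> \<inter> S)\<bar> \<le> ennreal (t * 2 powr \<beta>) * ?W (P \<inter> UNIV \<times> S)" .
    qed
    also have "\<dots> = ennreal (t * 2 powr \<beta>) * (\<integral>\<^sup>+S. ?W (P \<inter> UNIV \<times> S) \<partial>count_space \<D>)"
      by (rule nn_integral_cmult) simp
    also have "(\<integral>\<^sup>+S. ?W (P \<inter> UNIV \<times> S) \<partial>count_space \<D>) = ?W (\<Union>S\<in>\<D>. P \<inter> UNIV \<times> S)"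
    proof (rule emeasure_UN_countable[symmetric])
      show "disjoint_family_on (\<lambda>S. P \<inter> UNIV \<times> S) \<D>"
        using disj unfolding disjoint_family_on_def disjoint_def by blast
    qed (use count in auto)
    also have "ennreal (t * 2 powr \<beta>) * \<dots> \<le> ennreal (t * 2 powr \<beta>) * ?W P"
      by (intro mult_left_mono emeasure_cost_mono) auto
    finally show "ennreal \<bar>\<mu> (\<Union>\<D>)\<bar> \<le> ennreal (t * 2 powr \<beta>) * ?W P" .
  qed (use U_borel sub in auto)
qed

section \<open>Hausdorff null sets are null for the measure\<close>

lemma hausdorff_measure_mono:
  assumes "A \<subseteq> B"
  shows "hausdorff_measure \<beta> A \<le> hausdorff_measure \<beta> B"
proof -
  have "hausdorff_premeasure \<beta> \<delta> A \<le> hausdorff_premeasure \<beta> \<delta> B" for \<delta>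
    unfolding hausdorff_premeasure_def using assms
    by (intro Inf_superset_mono) blast
  then show ?thesis
    unfolding hausdorff_measure_def by (intro SUP_mono) blast
qed

text \<open>The approximation of \<open>A\<close> by a compact \<open>E\<close> inside an open \<open>V\<close> replaces a Hahn decomposition: the
union \<open>U\<close> of the stopping cubes satisfies \<open>E \<subseteq> U \<subseteq> V\<close>, so that \<open>\<mu> U\<close>, which is small,
differs little from \<open>\<mu> E\<close> and hence from \<open>\<mu> A\<close>. Cancellation inside the cubes is harmless,
because a stopping cube enters only through its own measure.\<close>

lemma hausdorff_null_imp_null_in_cube:
  fixes \<mu> :: "'a::euclidean_space set \<Rightarrow> real"
  assumes \<mu>: "signed_radon_measure \<mu>" and l: "0 < l" and \<beta>: "0 < \<beta>" "\<beta> \<le> real DIM('a)"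
    and fin: "choquet_integral (hausdorff_content \<beta>) (grid_cube c l 0 x0)
      (dyadic_frac_maximal (real DIM('a) - \<beta>) (cube c l) \<mu>) < \<infinity>"
    and A: "A \<in> sets borel" "A \<subseteq> grid_cube c l 0 x0" and null: "hausdorff_measure \<beta> A = 0"
  shows "\<mu> A = 0"
proof -
  let ?C = "grid_cube c l" and ?W = "emeasure (cost l \<beta>)" and ?d = "real DIM('a)"
  let ?Q = "?C 0 x0"
  let ?f = "dyadic_frac_maximal (?d - \<beta>) (cube c l) \<mu>"
  define M where "M = variation_measure \<mu> ?Q"
  have Q: "?Q \<in> sets borel" "bounded ?Q"
    using l by (auto intro: bounded_grid_cube)
  have le_M: "ennreal \<bar>\<mu> B\<bar> \<le> emeasure M B'"
    if "B \<in> sets borel" "B \<subseteq> ?Q" "B \<subseteq> B'" "B' \<in> sets borel" for B B'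
  proof -
    have "ennreal \<bar>\<mu> B\<bar> \<le> total_variation \<mu> B"
      using that Q by (intro abs_le_total_variation) (auto intro: bounded_subset)
    also have "\<dots> \<le> total_variation \<mu> (B' \<inter> ?Q)"
      using that by (intro total_variation_mono) auto
    finally show ?thesis
      using that by (simp add: M_def emeasure_variation_measure[OF \<mu> Q(1)])
  qed
  have "\<bar>\<mu> A\<bar> \<le> 3 * \<eta>" if \<eta>: "0 < \<eta>" for \<eta>
  proof -
    obtain E V where EV: "compact E" "open V" "E \<subseteq> A" "E \<subseteq> V"
      "emeasure M (A - E) < ennreal \<eta>" "emeasure M (V - E) < ennreal \<eta>"
    proof (rule measure_regular_approximation[OF _ _ A(1) \<eta>])
      show "sets M = sets borel" by (simp add: M_def)
      show "emeasure M (space M) \<noteq> \<infinity>"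
        using finite_variation_measure[OF \<mu> Q] by (simp add: M_def)
    qed blast
    have E_borel: "E \<in> sets borel" using EV(1) by (simp add: compact_imp_closed)
    obtain \<delta> where \<delta>: "0 < \<delta>" "(\<Union>x\<in>E. ball x \<delta>) \<subseteq> V"
      using compact_subset_open_imp_ball_epsilon_subset[OF EV(1,2,4)] by blast
    define s where "s = \<delta> / ?d"
    have s: "0 < s" using \<delta> by (simp add: s_def)
    define N :: real where "N = 5 ^ DIM('a)"
    have N: "0 < N" by (simp add: N_def)
    define b where "b = 2 powr \<beta> / unit_ball_vol \<beta>"
    have b: "0 < b" using \<beta> by (simp add: b_def)
    \<comment> \<open>chosen so that the cover below costs at most \<open>\<eta> / (2\<^sup>\<beta> t)\<close>\<close>
    define \<epsilon> where "\<epsilon> = \<eta> / (2 powr \<beta> * (N * (b + 2)))"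
    have \<epsilon>: "0 < \<epsilon>" using \<eta> N b by (simp add: \<epsilon>_def)
    \<comment> \<open>for \<open>t \<ge> T\<close> \<open>\<bar>\<mu> Q\<bar> \<le> t l\<^sup>\<beta>\<close>, and stopping cubes have side at most \<open>s\<close>\<close>
    define T where "T = Max {1, \<bar>\<mu> ?Q\<bar> / l powr \<beta>, \<eta> / s powr \<beta>}"
    have T: "1 \<le> T" "\<bar>\<mu> ?Q\<bar> / l powr \<beta> \<le> T" "\<eta> / s powr \<beta> \<le> T"
      unfolding T_def by (rule Max_ge; simp)+
    have T0: "0 < T" using T by simp
    obtain t where t: "T \<le> t"
      "ennreal t * hausdorff_content \<beta> {x \<in> ?Q. ennreal t < ?f x} < ennreal \<epsilon>"
      using choquet_integral_finite_imp_small[OF fin T0 \<epsilon>] by blast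
    have t0: "0 < t" using t(1) T0 by simp
    let ?G = "{x \<in> ?Q. ennreal t < ?f x}"
    have "hausdorff_content \<beta> ?G < ennreal (\<epsilon> / t)"
    proof (rule ccontr)
      assume "\<not> ?thesis"
      then have "ennreal t * ennreal (\<epsilon> / t) \<le> ennreal t * hausdorff_content \<beta> ?G"
        by (intro mult_left_mono) (auto simp: not_less)
      moreover have "ennreal t * ennreal (\<epsilon> / t) = ennreal \<epsilon>"
        using t0 \<epsilon> by (simp flip: ennreal_mult)
      ultimately show False using t(2) by simp
    qed
    moreover have \<epsilon>t: "0 < \<epsilon> / t" using \<epsilon> t0 by simp
    ultimately obtain P1 where P1: "countable P1" "?G \<subseteq> (\<Union>(k, y)\<in>P1. ?C k y)"
      "?W P1 \<le> ennreal (N * (b * (\<epsilon> / t) + \<epsilon> / t))"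
      using hausdorff_content_grid_cover[OF l \<beta>(1) \<epsilon>t, of ?G c x0 "\<epsilon> / t"]
      unfolding N_def b_def by blast
    obtain P2 where P2: "countable P2" "A \<subseteq> (\<Union>(k, y)\<in>P2. ?C k y)" "?W P2 \<le> ennreal (N * (\<epsilon> / t))"
      using hausdorff_null_grid_cover[OF l \<beta>(1) \<epsilon>t A(2) null] unfolding N_def by blast
    define P where "P = P1 \<union> P2"
    have "?W P \<le> ?W P1 + ?W P2"
      unfolding P_def by (rule emeasure_subadditive) auto
    also have "\<dots> \<le> ennreal (N * (b * (\<epsilon> / t) + \<epsilon> / t)) + ennreal (N * (\<epsilon> / t))"
      by (rule add_mono[OF P1(3) P2(3)])
    also have "\<dots> = ennreal (N * (b * (\<epsilon> / t) + \<epsilon> / t) + N * (\<epsilon> / t))"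
      by (intro ennreal_plus[symmetric] mult_nonneg_nonneg add_nonneg_nonneg
          less_imp_le[OF N] less_imp_le[OF b] less_imp_le[OF \<epsilon>t])
    also have "N * (b * (\<epsilon> / t) + \<epsilon> / t) + N * (\<epsilon> / t) = \<eta> / (2 powr \<beta> * t)"
    proof -
      have collect: "N * (b * q + q) + N * q = N * (b + 2) * q" for q
        by (simp only: distrib_left distrib_right mult_2 mult.assoc add.assoc mult_1_left
            one_add_one[symmetric])
      have cancel: "r * (\<eta> / (2 powr \<beta> * r) / t) = \<eta> / (2 powr \<beta> * t)" if "0 < r" for r :: real
        using that by simp
      show ?thesis
        unfolding collect \<epsilon>_def by (rule cancel) (use N b in simp)
    qed
    finally have W: "?W P \<le> ennreal (\<eta> / (2 powr \<beta> * t))" .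
    have W2: "ennreal (2 powr \<beta>) * ?W P \<le> ennreal (\<eta> / t)"
    proof -
      have "ennreal (2 powr \<beta>) * ?W P \<le> ennreal (2 powr \<beta>) * ennreal (\<eta> / (2 powr \<beta> * t))"
        by (rule mult_left_mono[OF W]) simp
      also have "\<dots> = ennreal (\<eta> / t)"
        using t0 \<eta> by (simp flip: ennreal_mult)
      finally show ?thesis .
    qed
    have stopping: "\<exists>k. stopping_cube l \<beta> t \<mu> P k (?C k x)" if x: "x \<in> E" for x
    proof (rule stopping_cube_exists[OF l \<beta>])
      have xQ: "x \<in> ?Q" using x EV(3) A(2) by blast
      show "countable P" using P1 P2 by (simp add: P_def)
      have "x \<in> (\<Union>(k, y)\<in>P2. ?C k y)"
        by (rule subsetD[OF P2(2) subsetD[OF EV(3) x]])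
      then show "x \<in> (\<Union>(k, y)\<in>P. ?C k y)" by (simp add: P_def)
      have "\<bar>\<mu> ?Q\<bar> / l powr \<beta> \<le> t" using T(2) t(1) by simp
      then show "\<bar>\<mu> (?C 0 x)\<bar> \<le> t * l powr \<beta>"
        using l grid_cube_eq[OF xQ] by (simp add: pos_divide_le_eq)
      fix j assume "t * mesh l j powr \<beta> < \<bar>\<mu> (?C j x)\<bar>"
      then have "ennreal t < ?f y" if "y \<in> ?C j x" for y
        using grid_cube_subset_maximal_superlevel[OF l less_imp_le[OF t0]] that by blast
      moreover have "?C j x \<subseteq> ?Q"
        using grid_cube_antimono[of 0 j c l x] grid_cube_eq[OF xQ] by simp
      ultimately have "?C j x \<subseteq> ?G" by auto
      also note P1(2)
      also have "(\<Union>(k, y)\<in>P1. ?C k y) \<subseteq> (\<Union>(k, y)\<in>P. ?C k y)"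
        by (rule UN_mono) (simp_all add: P_def)
      finally show "?C j x \<subseteq> (\<Union>(k, y)\<in>P. ?C k y)" .
    qed
    have small: "?C k x \<subseteq> V" if x: "x \<in> E" and k: "stopping_cube l \<beta> t \<mu> P k (?C k x)" for k x
    proof -
      have "ennreal (mesh l k powr \<beta>) \<le> ennreal (2 powr \<beta>) * ?W (P \<inter> UNIV \<times> ?C k x)"
        using k by (simp add: stopping_cube_def)
      also have "\<dots> \<le> ennreal (2 powr \<beta>) * ?W P"
        by (intro mult_left_mono emeasure_cost_mono) auto
      also note W2
      finally have "mesh l k powr \<beta> \<le> \<eta> / t"
        using t0 \<eta> by simp
      also have "\<dots> \<le> s powr \<beta>"
      proof -
        have "\<eta> \<le> t * s powr \<beta>"
          using order_trans[OF T(3) t(1)] s by (simp add: pos_divide_le_eq)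
        then show ?thesis using t0 by (simp add: pos_divide_le_eq mult.commute)
      qed
      finally have "mesh l k \<le> s"
        using powr_less_mono2[OF \<beta>(1) less_imp_le[OF s], of "mesh l k"] by linarith
      then have "?d * mesh l k \<le> \<delta>"
        by (simp add: s_def pos_le_divide_eq mult.commute)
      then have "dist x y < \<delta>" if "y \<in> ?C k x" for y
        using dist_grid_cube_less[OF l that] by linarith
      then have "?C k x \<subseteq> ball x \<delta>" by auto
      with \<delta>(2) x show ?thesis by blast
    qed
    have EQ: "E \<subseteq> ?Q" using EV(3) A(2) by blast
    obtain U where U: "E \<subseteq> U" "U \<in> sets borel" "U \<subseteq> ?Q"
      "\<And>u. u \<in> U \<Longrightarrow> \<exists>x\<in>E. \<exists>k. stopping_cube l \<beta> t \<mu> P k (?C k x) \<and> u \<in> ?C k x"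
      "ennreal \<bar>\<mu> U\<bar> \<le> ennreal (t * 2 powr \<beta>) * ?W P"
      using stopping_cubes_union_bound[OF \<mu> l less_imp_le[OF t0] EQ stopping] by blast
    have UV: "U \<subseteq> V" using U(4) small by blast
    have "ennreal (t * 2 powr \<beta>) * ?W P = ennreal t * (ennreal (2 powr \<beta>) * ?W P)"
      using t0 by (simp add: ennreal_mult mult.assoc)
    also have "\<dots> \<le> ennreal t * ennreal (\<eta> / t)"
      by (rule mult_left_mono[OF W2]) simp
    also have "\<dots> = ennreal \<eta>"
      using t0 \<eta> by (simp flip: ennreal_mult)
    finally have "ennreal (t * 2 powr \<beta>) * ?W P \<le> ennreal \<eta>" .
    from order_trans[OF U(5) this] have \<mu>U: "\<bar>\<mu> U\<bar> \<le> \<eta>"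
      using \<eta> by simp
    have "ennreal \<bar>\<mu> (U - E)\<bar> \<le> emeasure M (V - E)"
      using U UV E_borel EV(2) by (intro le_M) auto
    also note EV(6)
    finally have \<mu>UE: "\<bar>\<mu> (U - E)\<bar> \<le> \<eta>"
      by (simp add: ennreal_less_iff)
    have "ennreal \<bar>\<mu> (A - E)\<bar> \<le> emeasure M (A - E)"
      using A E_borel by (intro le_M) auto
    also note EV(5)
    finally have \<mu>AE: "\<bar>\<mu> (A - E)\<bar> \<le> \<eta>"
      by (simp add: ennreal_less_iff)
    have split: "\<mu> B = \<mu> E + \<mu> (B - E)" if B: "B \<in> sets borel" "E \<subseteq> B" "B \<subseteq> ?Q" for B
    proof -
      have "bounded E" "bounded (B - E)"
        using B EQ Q(2) by (auto intro: bounded_subset)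
      then have "\<mu> (E \<union> (B - E)) = \<mu> E + \<mu> (B - E)"
        using B E_borel by (intro signed_measure_Un[OF \<mu>]) auto
      then show ?thesis using B(2) by (simp add: Un_absorb1)
    qed
    show ?thesis
      using split[OF A(1) EV(3) A(2)] split[OF U(2,1,3)] \<mu>U \<mu>UE \<mu>AE by linarith
  qed
  from this[of "\<bar>\<mu> A\<bar> / 6"] show ?thesis by auto
qed

theorem theorem5:
  fixes \<mu> :: "'a::euclidean_space set \<Rightarrow> real"
    and \<beta> :: real
    and Q0 :: "'a set"
  assumes "0 < \<beta>" and "\<beta> \<le> real DIM('a)"
    and "is_cube Q0"
    and "signed_radon_measure \<mu>"
    and "\<And>Q. is_cube Q \<Longrightarrow>
      choquet_integral (hausdorff_content \<beta>) Q
        (dyadic_frac_maximal (real DIM('a) - \<beta>) Q0 \<mu>) < \<infinity>"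
  shows "lower_hausdorff_dim \<mu> \<ge> ennreal \<beta>"
proof -
  note \<mu> = assms(4)
  obtain c l where l: "0 < l" and Q0: "Q0 = cube c l"
    using assms(3) by (auto simp: is_cube_def)
  let ?\<D> = "range (grid_cube c l 0)"
  have disj: "disjoint ?\<D>"
    by (rule disjointI) (use grid_cube_eq in blast)
  have "\<mu> A = 0"
    if A: "A \<in> sets borel" "bounded A" and null: "hausdorff_measure \<beta> A = 0" for A
  proof -
    have "\<mu> (A \<inter> S) = 0" if "S \<in> ?\<D>" for S
    proof -
      obtain x0 where S: "S = grid_cube c l 0 x0" using \<open>S \<in> ?\<D>\<close> by blast
      have "hausdorff_measure \<beta> (A \<inter> S) = 0"
        using hausdorff_measure_mono[of "A \<inter> S" A \<beta>] null by simp
      then show ?thesis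
        using assms(5)[OF is_cube_grid_cube[OF l, of c 0 x0]] A(1) l unfolding S Q0
        by (intro hausdorff_null_imp_null_in_cube[OF \<mu> l assms(1,2), of c x0]) auto
    qed
    then have "(\<integral>\<^sup>+S. ennreal \<bar>\<mu> (A \<inter> S)\<bar> \<partial>count_space ?\<D>) = 0"
      by (subst nn_integral_cong[of _ _ "\<lambda>_. 0"]) auto
    moreover have "ennreal \<bar>\<mu> A\<bar> \<le> (\<integral>\<^sup>+S. ennreal \<bar>\<mu> (A \<inter> S)\<bar> \<partial>count_space ?\<D>)"
      using A l by (intro abs_signed_measure_le_partition[OF \<mu> countable_grid_cubes disj])
        (auto intro: mem_grid_cube_self)
    ultimately show ?thesis by simp
  qed
  then have "total_variation \<mu> E = 0" if "hausdorff_measure \<beta> E = 0" for E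
    using that hausdorff_measure_mono[of _ E \<beta>] unfolding total_variation_def
    by (intro antisym SUP_least) (auto intro!: sum.neutral)
  then show ?thesis
    unfolding lower_hausdorff_dim_def using assms(1,2) by (intro SUP_upper) auto
qed

end
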